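(* Let $G$ be a planar quadrangulation (without boundary, or finite with a boundary), with positive real variables $g=(g_v)_{v\in V}$ on its vertices. Let $x\in V$ be a vertex of degree $3$ surrounded by three internal faces, so that a cube flip can be performed at $x$, giving a graph $G'$. Write $g=g_x$ for the variable at $x$, $g_1,g_2,g_3$ for the variables at the three neighbours of $x$, and $g_{12},g_{13},g_{23}$ for the variables at the vertices opposite to $x$ in the three faces around $x$ ($g_{ij}$ being in the face that contains the neighbours carrying $g_i$ and $g_j$). Let $g'$ be the family of variables on the vertices of $G'$ equal to $g$ everywhere except at $x$, where its value is $g'_x$. Suppose $g$ satisfies Kashaev's recurrence at $x$, i.e. $g'_x=g_{123}$ with $$g_{123}=\frac{2g_1g_2g_3+g\,(g_1g_{23}+g_2g_{13}+g_3g_{12})+2XYZ}{g^2},$$ $$X=\sqrt{g g_{23}+g_2g_3},\quad Y=\sqrt{g g_{13}+g_1g_3},\quad Z=\sqrt{g g_{12}+g_1g_2}.$$ Then $$\frac{1}{g_x^2}\,\mathcal{Z}^{G}_{\mathrm{m.loop}}(g)=\frac{1}{(g'_x)^2}\,\mathcal{Z}^{G'}_{\mathrm{m.loop}}(g').$$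
   Context: A planar quadrangulation without boundary is a finite connected simple graph embedded in the sphere all of whose faces are disks of degree $4$. A quadrangulation with a boundary is a finite simple graph properly embedded in the plane such that all internal (bounded) faces have degree $4$. Below, "faces" means all faces in the first case and internal faces in the second. Local configurations and weights. For a face $f$ with boundary vertices $x,u,y,v$ in cyclic order (so $x,y$ are opposite and $u,v$ are opposite), the midpoints of the four sides are joined in pairs by two strands, each coloured red or blue. A strand "turns around" a corner $p$ if it joins the midpoints of the two sides of $f$ incident to $p$. The ten local configurations and their weights are: - $1_a,1_b$: strands turn around $u$ and $v$, same colour; weight $w^f_1=g_xg_y$; - $2_a,2_b$: strands turn around $x$ and $y$, same colour; weight $w^f_2=g_ug_v$; - $3_a,3_b$: strands turn around $u$ and $v$, different colours; weight $w^f_3=\sqrt{g_xg_y}\sqrt{g_xg_y+g_ug_v}$; - $4_a,4_b$: strands turn around $x$ and $y$, different colours; weight $w^f_4=\sqrt{g_ug_v}\sqrt{g_xg_y+g_ug_v}$; - $5_a,5_b$: strands join opposite sides (they cross), different colours; weight $w^f_5=\sqrt{g_xg_yg_ug_v}$. (These weights do not depend on which opposite pair is called $\{x,y\}$.) A $C^{(1)}_2$ loop configuration on $G$ is a choice of a local configuration at each face such that the colours agree on the two sides of each edge common to two faces; the strands glue into red and blue loops and (if there is a boundary) paths ending on external half-edges. If $G$ has a boundary, a boundary condition is fixed: e.g. free boundary conditions, or a prescription of the colours of the paths on the external half-edges, or a prescription of how the paths starting on external edges are connected inside the graph (for both colours). The same boundary condition is used for $G$ and $G'$. A marked $C^{(1)}_2$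 loop configuration is a $C^{(1)}_2$ loop configuration in which every red edge is marked with an index $0$ or $2$ and every blue edge with an index $A$ or $B$, so that the index stays constant along a path except when a path of the other colour is crossed, in which case the index has to change. The weight of a marked configuration is $\prod_{f}w^f_i$, where $i$ is the type of the local configuration at $f$ (no factor for the number of loops), and $\mathcal Z^G_{\mathrm{m.loop}}(g)$ is the sum of the weights of all marked configurations on $G$ (satisfying the boundary condition, if any). Cube flip. At a degree $3$ vertex $x$ whose three adjacent faces form a hexagon with boundary vertices carrying, in cyclic order, the variables $g_1,g_{12},g_2,g_{23},g_3,g_{13}$, with $x$ joined to the vertices carrying $g_1,g_2,g_3$, the cube flip deletes the three edges at $x$ and joins $x$ instead to the three vertices carrying $g_{12},g_{13},g_{23}$, leaving the rest of the graph unchanged; the result is $G'$. *)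

theory Defs
  imports
    Complex_Main
    "HOL-Library.FuncSet"
    "HOL-Combinatorics.Orbits"
    "Graph_Theory.Pair_Digraph"
    "Graph_Theory.Digraph_Component"
begin

section \<open>Quadrangulations\<close>

text \<open>
  An embedded finite simple graph is given by a rotation system: \<open>rot M v u\<close> is the neighbour of
  \<open>v\<close> that follows \<open>u\<close> in the cyclic order around \<open>v\<close> (for either of the two orientations of the
  surface). An undirected graph is a symmetric loop-free digraph. Its arcs are called darts; the
  dart \<open>(u, v)\<close> is a side of exactly one face, the one whose boundary walk contains it. \<open>outer M\<close> is
  the set of the sides of the outer face; it is empty for a graph drawn on the sphere without
  boundary.
\<close>

type_synonym 'v dart = "'v \<times> 'v"

record 'v quad_map =
  ugraph :: "'v pair_pre_digraph"
  rot :: "'v \<Rightarrow> 'v \<Rightarrow> 'v"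
  outer :: "'v dart set"

abbreviation vertices :: "'v quad_map \<Rightarrow> 'v set" where
  "vertices M \<equiv> pverts (ugraph M)"

abbreviation darts :: "'v quad_map \<Rightarrow> 'v dart set" where
  "darts M \<equiv> parcs (ugraph M)"

definition nbrs :: "'v quad_map \<Rightarrow> 'v \<Rightarrow> 'v set" where
  "nbrs M v = {u. (v, u) \<in> darts M}"

definition edges :: "'v quad_map \<Rightarrow> 'v set set" where
  "edges M = (\<lambda>(u, v). {u, v}) ` darts M"

definition embedded_graph :: "'v quad_map \<Rightarrow> bool" where
  "embedded_graph M \<longleftrightarrow> pair_graph (ugraph M) \<and>
     (\<forall>v\<in>vertices M. nbrs M v \<noteq> {} \<longrightarrow> cyclic_on (rot M v) (nbrs M v))"

definition fnext :: "'v quad_map \<Rightarrow> 'v dart \<Rightarrow> 'v dart" where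
  "fnext M d = (snd d, rot M (snd d) (fst d))"

text \<open>A face is represented by the set of its sides, so its cardinality is its degree.\<close>

definition faces :: "'v quad_map \<Rightarrow> 'v dart set set" where
  "faces M = orbit (fnext M) ` darts M"

definition internal_faces :: "'v quad_map \<Rightarrow> 'v dart set set" where
  "internal_faces M = {f \<in> faces M. f \<inter> outer M = {}}"

definition internal_darts :: "'v quad_map \<Rightarrow> 'v dart set" where
  "internal_darts M = darts M - outer M"

text \<open>A connected rotation system is one of the sphere iff Euler's formula holds.\<close>

definition planar_quadrangulation :: "'v quad_map \<Rightarrow> bool" where
  "planar_quadrangulation M \<longleftrightarrow>
     embedded_graph M \<and> outer M = {} \<and> connected (with_proj (ugraph M)) \<and>
     card (vertices M) + card (faces M) = card (edges M) + 2 \<and>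
     (\<forall>f\<in>faces M. card f = 4)"

definition components :: "'v quad_map \<Rightarrow> 'v set set" where
  "components M = pre_digraph.sccs_verts (with_proj (ugraph M))"

text \<open>
  A quadrangulation with a boundary need not be connected. Its bounded faces have degree 4, so that
  no component with an edge lies inside a bounded face of another one; hence exactly one facial walk
  of each component with an edge belongs to the outer face. Adding Euler's formula over the
  components (an isolated vertex has no facial walk in this representation) gives
  \<open>|V| - |E| + |F_int| = number of components\<close>. Conversely, as every component satisfies
  \<open>|V| - |E| + |F| \<le> 2\<close>, this equality forces every component to be planar.
\<close>

definition quadrangulation_with_boundary :: "'v quad_map \<Rightarrow> bool" where
  "quadrangulation_with_boundary M \<longleftrightarrow>
     embedded_graph M \<and>
     outer M \<subseteq> darts M \<and> fnext M ` outer M \<subseteq> outer M \<and>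
     (\<forall>C\<in>components M. (\<exists>v\<in>C. nbrs M v \<noteq> {}) \<longrightarrow>
        (\<exists>!f. f \<in> faces M \<and> f \<subseteq> outer M \<and> fst ` f \<subseteq> C)) \<and>
     card (vertices M) + card (internal_faces M) = card (edges M) + card (components M) \<and>
     (\<forall>f\<in>internal_faces M. card f = 4)"


section \<open>The cube flip\<close>

text \<open>
  The vertex \<open>x\<close> has degree 3 with neighbours \<open>v1\<close>, \<open>v2\<close>, \<open>v3\<close>, listed in the cyclic order of the
  rotation at \<open>x\<close>; the three internal faces around \<open>x\<close> form the hexagon
  \<open>v1, v12, v2, v23, v3, v13\<close>. As the graph after the flip has to be simple, these six vertices are
  distinct.
\<close>

definition cube_hexagon ::
  "'v quad_map \<Rightarrow> 'v \<Rightarrow> 'v \<Rightarrow> 'v \<Rightarrow> 'v \<Rightarrow> 'v \<Rightarrow> 'v \<Rightarrow> 'v \<Rightarrow> bool" where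
  "cube_hexagon M x v1 v12 v2 v23 v3 v13 \<longleftrightarrow>
     x \<in> vertices M \<and> nbrs M x = {v1, v2, v3} \<and> distinct [x, v1, v12, v2, v23, v3, v13] \<and>
     {(v1, x), (x, v2), (v2, v12), (v12, v1)} \<in> internal_faces M \<and>
     {(v2, x), (x, v3), (v3, v23), (v23, v2)} \<in> internal_faces M \<and>
     {(v3, x), (x, v1), (v1, v13), (v13, v3)} \<in> internal_faces M"

text \<open>
  In the rotations, \<open>x\<close> is deleted at \<open>v1\<close>, \<open>v2\<close>, \<open>v3\<close>, and it is inserted at \<open>v12\<close>, \<open>v23\<close>, \<open>v13\<close>
  between the two consecutive neighbours that lie on the hexagon.
\<close>

definition cube_flip ::
  "'v quad_map \<Rightarrow> 'v \<Rightarrow> 'v \<Rightarrow> 'v \<Rightarrow> 'v \<Rightarrow> 'v \<Rightarrow> 'v \<Rightarrow> 'v \<Rightarrow> 'v quad_map" where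
  "cube_flip M x v1 v12 v2 v23 v3 v13 = M\<lparr>
     ugraph := \<lparr>pverts = vertices M,
       parcs = {(a, b) \<in> darts M. a \<noteq> x \<and> b \<noteq> x} \<union>
         {x} \<times> {v12, v23, v13} \<union> {v12, v23, v13} \<times> {x}\<rparr>,
     rot := (rot M)(
       x := (rot M x)(v12 := v23, v23 := v13, v13 := v12),
       v1 := (rot M v1)(v12 := v13),
       v2 := (rot M v2)(v23 := v12),
       v3 := (rot M v3)(v13 := v23),
       v12 := (rot M v12)(v2 := x, x := v1),
       v23 := (rot M v23)(v3 := x, x := v2),
       v13 := (rot M v13)(v1 := x, x := v3))\<rparr>"


section \<open>Loop configurations\<close>

datatype colour = Red | Blue

text \<open>
  The strands are encoded by \<open>p\<close> and \<open>c\<close>: the strand that starts at the midpoint of the side \<open>d\<close> of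
  a face ends at the midpoint of the side \<open>p d\<close> of the same face and has colour \<open>c d\<close>. On a face of
  degree 4 there are ten such configurations: three pairings of the sides with four colourings
  each, minus the two crossings of strands of the same colour.
\<close>

definition local_config ::
  "'v quad_map \<Rightarrow> 'v dart set \<Rightarrow> ('v dart \<Rightarrow> 'v dart) \<Rightarrow> ('v dart \<Rightarrow> colour) \<Rightarrow> bool" where
  "local_config M f p c \<longleftrightarrow>
     (\<forall>d\<in>f. p d \<in> f \<and> p d \<noteq> d \<and> p (p d) = d \<and> c (p d) = c d \<and>
        (p d = fnext M (fnext M d) \<longrightarrow> c (fnext M d) \<noteq> c d))"

datatype local_type = Type1 | Type2 | Type3 | Type4 | Type5

text \<open>
  The type of the configuration at the face with boundary vertices \<open>x, u, y, v\<close> whose side \<open>d\<close> joins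
  \<open>x\<close> to \<open>u\<close>. The sides \<open>d\<close> and \<open>fnext M d\<close> meet at \<open>u\<close>: if \<open>p\<close> pairs them, then the strands turn
  around \<open>u\<close> and \<open>v\<close>. One of the two strands contains the midpoint of \<open>d\<close>, and unless they cross the
  other one contains the midpoint of the opposite side.
\<close>

definition local_type ::
  "'v quad_map \<Rightarrow> ('v dart \<Rightarrow> 'v dart) \<Rightarrow> ('v dart \<Rightarrow> colour) \<Rightarrow> 'v dart \<Rightarrow> local_type" where
  "local_type M p c d =
     (if p d = fnext M (fnext M d) then Type5
      else if p d = fnext M d
        then (if c d = c (fnext M (fnext M d)) then Type1 else Type3)
        else (if c d = c (fnext M (fnext M d)) then Type2 else Type4))"

fun type_weight :: "local_type \<Rightarrow> real \<Rightarrow> real \<Rightarrow> real \<Rightarrow> real \<Rightarrow> real" where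
  "type_weight Type1 gx gu gy gv = gx * gy"
| "type_weight Type2 gx gu gy gv = gu * gv"
| "type_weight Type3 gx gu gy gv = sqrt (gx * gy) * sqrt (gx * gy + gu * gv)"
| "type_weight Type4 gx gu gy gv = sqrt (gu * gv) * sqrt (gx * gy + gu * gv)"
| "type_weight Type5 gx gu gy gv = sqrt (gx * gy * gu * gv)"

definition weight_from ::
  "'v quad_map \<Rightarrow> ('v \<Rightarrow> real) \<Rightarrow> ('v dart \<Rightarrow> 'v dart) \<Rightarrow> ('v dart \<Rightarrow> colour) \<Rightarrow> 'v dart \<Rightarrow> real" where
  "weight_from M g p c d =
     (let x = fst d; u = fst (fnext M d); y = fst (fnext M (fnext M d));
          v = fst (fnext M (fnext M (fnext M d)))
      in type_weight (local_type M p c d) (g x) (g u) (g y) (g v))"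

text \<open>The choice of the side is irrelevant by \<open>weight_from_fnext\<close> below.\<close>

definition face_weight ::
  "'v quad_map \<Rightarrow> ('v \<Rightarrow> real) \<Rightarrow> ('v dart \<Rightarrow> 'v dart) \<Rightarrow> ('v dart \<Rightarrow> colour) \<Rightarrow>
     'v dart set \<Rightarrow> real" where
  "face_weight M g p c f = weight_from M g p c (SOME d. d \<in> f)"

lemma weight_from_fnext:
  fixes M :: "'v quad_map" and d :: "'v dart"
  defines "s \<equiv> fnext M"
  assumes f: "f = {d, s d, s (s d), s (s (s d))}" "card f = 4" "s (s (s (s d))) = d"
    and lc: "local_config M f p c"
  shows "weight_from M g p c (s d) = weight_from M g p c d"
proof -
  have dist: "d \<noteq> s d" "d \<noteq> s (s d)" "d \<noteq> s (s (s d))" "s d \<noteq> s (s d)" "s d \<noteq> s (s (s d))"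
    "s (s d) \<noteq> s (s (s d))"
    using f(1,2) by (auto simp: card_insert_if split: if_splits)
  have L: "p e \<in> f" "p e \<noteq> e" "p (p e) = e" "c (p e) = c e" if "e \<in> f" for e
    using lc that by (auto simp: local_config_def)
  have mem: "d \<in> f" "s d \<in> f" "s (s d) \<in> f" "s (s (s d)) \<in> f"
    using f(1) by auto
  consider "p d = s d" | "p d = s (s d)" | "p d = s (s (s d))"
    using L(1,2)[OF mem(1)] f(1) by auto
  then show ?thesis
  proof cases
    case 1
    then have 2: "p (s d) = d" using L(3)[OF mem(1)] by simp
    have "p (s (s d)) = s (s (s d))"
      using L[OF mem(3)] 1 2 dist f(1) by auto
    then have "c (s (s (s d))) = c (s (s d))" "c (s d) = c d"
      using L(4)[OF mem(3)] L(4)[OF mem(1)] 1 by auto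
    then show ?thesis
      using 1 2 dist f(3) unfolding weight_from_def local_type_def s_def[symmetric]
      by (auto simp: Let_def mult.commute add.commute)
  next
    case 2
    then have 1: "p (s (s d)) = d" using L(3)[OF mem(1)] by simp
    have "p (s d) = s (s (s d))"
      using L[OF mem(2)] 1 2 dist f(1) by auto
    then show ?thesis
      using 2 dist f(3) unfolding weight_from_def local_type_def s_def[symmetric]
      by (auto simp: Let_def mult_ac)
  next
    case 3
    then have 1: "p (s (s (s d))) = d" using L(3)[OF mem(1)] by simp
    have 2: "p (s d) = s (s d)"
      using L[OF mem(2)] 1 3 dist f(1) by auto
    then have "c (s (s d)) = c (s d)" "c (s (s (s d))) = c d"
      using L(4)[OF mem(2)] L(4)[OF mem(1)] 3 by auto
    then show ?thesis
      using 2 3 dist f(3) unfolding weight_from_def local_type_def s_def[symmetric]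
      by (auto simp: Let_def mult.commute add.commute)
  qed
qed

definition loop_configs ::
  "'v quad_map \<Rightarrow> (('v dart \<Rightarrow> 'v dart) \<times> ('v dart \<Rightarrow> colour)) set" where
  "loop_configs M = {(p, c).
     p \<in> internal_darts M \<rightarrow>\<^sub>E internal_darts M \<and> c \<in> internal_darts M \<rightarrow>\<^sub>E UNIV \<and>
     (\<forall>f\<in>internal_faces M. local_config M f p c) \<and>
     (\<forall>d\<in>internal_darts M. prod.swap d \<in> internal_darts M \<longrightarrow> c (prod.swap d) = c d)}"


section \<open>Boundary conditions\<close>

text \<open>The external half-edges are carried by the sides of internal faces that lie on the outer face.\<close>

definition boundary_darts :: "'v quad_map \<Rightarrow> 'v dart set" where
  "boundary_darts M = {d \<in> internal_darts M. prod.swap d \<in> outer M}"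

definition boundary_colours ::
  "'v quad_map \<Rightarrow> ('v dart \<Rightarrow> colour) \<Rightarrow> 'v dart \<Rightarrow> colour" where
  "boundary_colours M c = restrict c (boundary_darts M)"

definition strand_rel :: "'v quad_map \<Rightarrow> ('v dart \<Rightarrow> 'v dart) \<Rightarrow> 'v dart rel" where
  "strand_rel M p =
     {(d, p d) | d. d \<in> internal_darts M} \<union>
     {(d, prod.swap d) | d. d \<in> internal_darts M \<and> prod.swap d \<in> internal_darts M}"

definition boundary_connections :: "'v quad_map \<Rightarrow> ('v dart \<Rightarrow> 'v dart) \<Rightarrow> 'v dart rel" where
  "boundary_connections M p =
     {(d, e). d \<in> boundary_darts M \<and> e \<in> boundary_darts M \<and> d \<noteq> e \<and> (d, e) \<in> (strand_rel M p)\<^sup>*}"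

text \<open>
  A boundary condition is an arbitrary property of the colours of the paths on the external
  half-edges and of how these half-edges are connected by the paths. The free condition is
  \<open>\<lambda>_ _. True\<close>. Without boundary, all configurations have the same (empty) boundary data.
\<close>

type_synonym 'v boundary_condition = "('v dart \<Rightarrow> colour) \<Rightarrow> 'v dart rel \<Rightarrow> bool"

text \<open>The external half-edges are not affected by a cube flip.\<close>

lemma boundary_darts_cube_flip:
  assumes hex: "cube_hexagon M x v1 v12 v2 v23 v3 v13"
    and sym: "sym (darts M)" and outer: "outer M \<subseteq> darts M"
  shows "boundary_darts (cube_flip M x v1 v12 v2 v23 v3 v13) = boundary_darts M"
proof -
  have *: "a \<noteq> x \<and> b \<noteq> x" if o: "(a, b) \<in> outer M" for a b
  proof (rule ccontr)
    assume "\<not> ?thesis"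
    moreover have "(a, b) \<in> darts M" "(b, a) \<in> darts M"
      using o outer sym by (auto dest: symD)
    ultimately have "(a = x \<and> b \<in> nbrs M x) \<or> (b = x \<and> a \<in> nbrs M x)"
      by (auto simp: nbrs_def)
    then show False
      using hex o by (auto simp: cube_hexagon_def internal_faces_def)
  qed
  have o: "(a, x) \<notin> outer M" "(x, a) \<notin> outer M" for a
    using *[of a x] *[of x a] by auto
  show ?thesis
    by (auto simp: boundary_darts_def internal_darts_def cube_flip_def o)
qed


section \<open>Marked loop configurations\<close>

datatype mark = M0 | M2 | MA | MB

fun mark_colour :: "mark \<Rightarrow> colour" where
  "mark_colour M0 = Red"
| "mark_colour M2 = Red"
| "mark_colour MA = Blue"
| "mark_colour MB = Blue"

definition is_marking ::
  "'v quad_map \<Rightarrow> ('v dart \<Rightarrow> 'v dart) \<Rightarrow> ('v dart \<Rightarrow> colour) \<Rightarrow> ('v dart \<Rightarrow> mark) \<Rightarrow> bool" where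
  "is_marking M p c m \<longleftrightarrow>
     m \<in> internal_darts M \<rightarrow>\<^sub>E UNIV \<and>
     (\<forall>d\<in>internal_darts M. mark_colour (m d) = c d \<and>
        (prod.swap d \<in> internal_darts M \<longrightarrow> m (prod.swap d) = m d) \<and>
        (if p d = fnext M (fnext M d) then m (p d) \<noteq> m d else m (p d) = m d))"

definition marked_loop_configs ::
  "'v quad_map \<Rightarrow> 'v boundary_condition \<Rightarrow>
     (('v dart \<Rightarrow> 'v dart) \<times> ('v dart \<Rightarrow> colour) \<times> ('v dart \<Rightarrow> mark)) set" where
  "marked_loop_configs M bc = {(p, c, m).
     (p, c) \<in> loop_configs M \<and> is_marking M p c m \<and>
     bc (boundary_colours M c) (boundary_connections M p)}"

definition Z_mloop :: "'v quad_map \<Rightarrow> 'v boundary_condition \<Rightarrow> ('v \<Rightarrow> real) \<Rightarrow> real" where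
  "Z_mloop M bc g =
     (\<Sum>(p, c, m)\<in>marked_loop_configs M bc. \<Prod>f\<in>internal_faces M. face_weight M g p c f)"


section \<open>Kashaev's recurrence\<close>

definition kashaev :: "real \<Rightarrow> real \<Rightarrow> real \<Rightarrow> real \<Rightarrow> real \<Rightarrow> real \<Rightarrow> real \<Rightarrow> real" where
  "kashaev g g1 g2 g3 g12 g13 g23 =
     (let X = sqrt (g * g23 + g2 * g3);
          Y = sqrt (g * g13 + g1 * g3);
          Z = sqrt (g * g12 + g1 * g2)
      in (2 * g1 * g2 * g3 + g * (g1 * g23 + g2 * g13 + g3 * g12) + 2 * X * Y * Z) / g\<^sup>2)"

end

theory Submission
  imports Defs
begin

text \<open>
  The weight of a configuration is a product over the faces, and the flip only replaces the three
  faces around \<open>x\<close>. Fix the strands and marks outside of the hexagon, together with the marks on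
  its six sides. The inside of the hexagon then enters a summand in two ways only: through the
  weight of its three faces, and through the way in which its strands pair up the six sides of the
  hexagon, because nothing else about the inside is visible to a boundary condition. Hence it
  suffices to prove a local identity: for given marks on the hexagon and each of the fifteen
  pairings, the total weight of the inner configurations with this pairing, divided by the square
  of the variable at the centre, is the same before and after the flip (\<open>star_sum_flip\<close>).

  The marks on the inner edges are determined by those on the hexagon, except on a closed loop around
  the centre, which is free to carry any of the four marks. So for a given pairing the two sides of
  the local identity have very few terms. Turning the hexagon by two sides, and exchanging the star
  with the flipped star, reduces the fifteen pairings to four kinds with nonzero terms
  (\<open>flip_corner_strands\<close>, \<open>flip_parallel_strands\<close>, \<open>flip_one_crossing\<close>, \<open>flip_two_crossings\<close>);
  if all three pairs of strands cross, both sides vanish, as there are only two colours.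
  Let \<open>n\<^sub>k\<close> and \<open>o\<^sub>k\<close> be the variables at the neighbours of \<open>x\<close> and at the opposite vertices,
  \<open>X\<^sub>k\<close> the square roots in the recurrence and \<open>Y\<^sub>k\<close> the corresponding square roots after the flip.
  The recurrence implies the relations \<open>g Y\<^sub>0 = n\<^sub>1 X\<^sub>2 + X\<^sub>0 X\<^sub>1\<close>, and it is symmetric: it
  also gives \<open>g' X\<^sub>2 = o\<^sub>2 Y\<^sub>0 + Y\<^sub>1 Y\<^sub>2\<close> and expresses \<open>g\<close> by \<open>g'\<close> and the \<open>Y\<^sub>k\<close>
  (\<open>kashaev_cube_sqrt\<close>). These are exactly the identities needed for the four kinds of pairings.

  The global part consists of the decomposition of the partition function at a star
  (\<open>Z_mloop_decomposition\<close>), which rests on the fact that outer connections only depend on the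
  pairing of the hexagon (\<open>strand_connections\<close>), and of the determination of the faces of the flipped
  map (\<open>internal_faces_flip\<close>, \<open>star_flip\<close>, \<open>outside_flip\<close>). The flipped map has a star of the same
  form, with neighbours and opposite vertices exchanged, so one decomposition serves both maps.
\<close>

section \<open>Weights of a star with given marks on the hexagon\<close>

text \<open>
  The three ways to connect the sides of a face at the centre \<open>x\<close>: the strands turn around the two
  neighbours of \<open>x\<close>, or around \<open>x\<close> itself and the opposite vertex, or they cross.
\<close>
datatype turn = Nb | Ce | Cr

text \<open>
  The mark on the continuation of a strand after a crossing.
\<close>
fun partner :: "mark \<Rightarrow> mark" where
  "partner M0 = M2" | "partner M2 = M0" | "partner MA = MB" | "partner MB = MA"

lemma partner_iff: "b = partner a \<longleftrightarrow> mark_colour b = mark_colour a \<and> b \<noteq> a"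
  by (cases a; cases b) auto

lemma mark_colour_partner [simp]: "mark_colour (partner a) = mark_colour a"
  by (cases a) auto

lemma partner_partner [simp]: "partner (partner a) = a"
  by (cases a) auto

lemma UNIV_mark: "(UNIV :: mark set) = {M0, M2, MA, MB}"
  using mark_colour.cases by auto

instance mark :: finite
  by standard (simp add: UNIV_mark)

lemma UNIV_turn: "(UNIV :: turn set) = {Nb, Ce, Cr}"
  using turn.exhaust by auto

instance turn :: finite
  by standard (simp add: UNIV_turn)

text \<open>
  The arguments are the marks on the sides of a face in cyclic order, starting with the two spokes:
  the first two belong to the edges at the centre, the last two lie on the hexagon.
\<close>
fun marks_match :: "turn \<Rightarrow> mark \<Rightarrow> mark \<Rightarrow> mark \<Rightarrow> mark \<Rightarrow> bool" where
  "marks_match Nb a b c d \<longleftrightarrow> d = a \<and> c = b"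
| "marks_match Ce a b c d \<longleftrightarrow> b = a \<and> d = c"
| "marks_match Cr a b c d \<longleftrightarrow> c = partner a \<and> d = partner b \<and> mark_colour a \<noteq> mark_colour b"

text \<open>
  With \<open>p\<^sup>2 = g\<^sub>u g\<^sub>v\<close>, \<open>q\<^sup>2 = g\<^sub>x g\<^sub>y\<close> and \<open>z\<^sup>2 = p\<^sup>2 + q\<^sup>2\<close>, where \<open>u\<close> is the centre and \<open>v\<close> the
  vertex opposite to it, these are the five weights. The Boolean tells whether both strands have the
  same colour.
\<close>
fun turn_weight :: "turn \<Rightarrow> bool \<Rightarrow> real \<Rightarrow> real \<Rightarrow> real \<Rightarrow> real" where
  "turn_weight Nb e p q z = (if e then p\<^sup>2 else p * z)"
| "turn_weight Ce e p q z = (if e then q\<^sup>2 else q * z)"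
| "turn_weight Cr e p q z = p * q"

definition star_face :: "turn \<Rightarrow> mark \<Rightarrow> mark \<Rightarrow> mark \<Rightarrow> mark \<Rightarrow> real \<Rightarrow> real \<Rightarrow> real \<Rightarrow> real" where
  "star_face t a b c d p q z =
     (if marks_match t a b c d then turn_weight t (mark_colour a = mark_colour c) p q z else 0)"

lemma star_face_nonzero: "star_face t a b c d p q z \<noteq> 0 \<Longrightarrow> marks_match t a b c d"
  by (auto simp: star_face_def split: if_splits)

text \<open>
  The star seen from the hexagon: \<open>h0, ..., h5\<close> are the marks on the sides of the hexagon in cyclic
  order, where \<open>h0\<close> and \<open>h1\<close> meet at the first neighbour of the centre. The summation variables are
  the marks on the three spokes. The real parameters are square roots, as in this way all weights
  are polynomials: \<open>r\<close> belongs to the centre, \<open>a0, a1, a2\<close> to its neighbours and \<open>b0, b1, b2\<close> to the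
  opposite vertices.
\<close>
definition star_term :: "turn \<Rightarrow> turn \<Rightarrow> turn \<Rightarrow> mark \<Rightarrow> mark \<Rightarrow> mark \<Rightarrow> mark \<Rightarrow> mark \<Rightarrow> mark \<Rightarrow>
    real \<Rightarrow> real \<Rightarrow> real \<Rightarrow> real \<Rightarrow> real \<Rightarrow> real \<Rightarrow> real \<Rightarrow> real \<Rightarrow> real \<Rightarrow> real \<Rightarrow> real" where
  "star_term t0 t1 t2 h0 h1 h2 h3 h4 h5 r a0 a1 a2 b0 b1 b2 X0 X1 X2 =
     (\<Sum>m0\<in>UNIV. \<Sum>m1\<in>UNIV. \<Sum>m2\<in>UNIV.
        star_face t0 m0 m1 h2 h1 (r * b0) (a0 * a1) X0 *
        star_face t1 m1 m2 h4 h3 (r * b1) (a1 * a2) X1 *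
        star_face t2 m2 m0 h0 h5 (r * b2) (a2 * a0) X2)"

text \<open>
  The marks on the spokes are usually forced by the marks on the hexagon; then a triple sum has a
  single summand.
\<close>
lemma sum3_single:
  fixes F :: "mark \<Rightarrow> mark \<Rightarrow> mark \<Rightarrow> real"
  assumes "\<And>a b c. F a b c \<noteq> 0 \<Longrightarrow> a = a0 \<and> b = b0 \<and> c = c0"
  shows "(\<Sum>a\<in>UNIV. \<Sum>b\<in>UNIV. \<Sum>c\<in>UNIV. F a b c) = F a0 b0 c0"
proof -
  have z: "F a b c = 0" if "a \<noteq> a0 \<or> b \<noteq> b0 \<or> c \<noteq> c0" for a b c
    using assms that by blast
  have "(\<Sum>c\<in>UNIV. F a b c) = (if a = a0 \<and> b = b0 then F a0 b0 c0 else 0)" for a b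
    using z by (auto simp: sum.remove[OF finite UNIV_I[of c0]] intro!: sum.neutral)
  moreover have "(\<Sum>b\<in>UNIV. if a = a0 \<and> b = b0 then F a0 b0 c0 else 0)
      = (if a = a0 then F a0 b0 c0 else 0)" for a
    by (cases "a = a0") auto
  ultimately show ?thesis by simp
qed

lemma star_term_rotate:
  "star_term t1 t2 t0 h2 h3 h4 h5 h0 h1 r a1 a2 a0 b1 b2 b0 X1 X2 X0 =
   star_term t0 t1 t2 h0 h1 h2 h3 h4 h5 r a0 a1 a2 b0 b1 b2 X0 X1 X2"
proof -
  have "(\<Sum>m0\<in>UNIV. \<Sum>m1\<in>UNIV. \<Sum>m2\<in>UNIV. F m2 m0 m1) =
      (\<Sum>m0\<in>UNIV. \<Sum>m1\<in>UNIV. \<Sum>m2\<in>UNIV. F m0 m1 m2)" for F :: "mark \<Rightarrow> mark \<Rightarrow> mark \<Rightarrow> real"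
  proof -
    have "(\<Sum>m0\<in>UNIV. \<Sum>m1\<in>UNIV. \<Sum>m2\<in>UNIV. F m2 m0 m1) =
        (\<Sum>m0\<in>UNIV. \<Sum>m2\<in>UNIV. \<Sum>m1\<in>UNIV. F m2 m0 m1)"
      by (intro sum.cong refl sum.swap)
    then show ?thesis by (simp add: sum.swap[of "\<lambda>m0 m2. \<Sum>m1\<in>UNIV. F m2 m0 m1"])
  qed
  from this[of "\<lambda>m0 m1 m2. star_face t0 m0 m1 h2 h1 (r * b0) (a0 * a1) X0 *
        star_face t1 m1 m2 h4 h3 (r * b1) (a1 * a2) X1 *
        star_face t2 m2 m0 h0 h5 (r * b2) (a2 * a0) X2"]
  show ?thesis unfolding star_term_def by (simp add: mult_ac)
qed

text \<open>
  All the variables stand for square roots. The letters \<open>r\<close> and \<open>s\<close> belong to the centre before and after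
  the flip, and \<open>X0, X1, X2\<close> and \<open>Y0, Y1, Y2\<close> are the roots of the sums \<open>g\<^sub>x g\<^sub>y + g\<^sub>u g\<^sub>v\<close> for the three
  faces before and after the flip. The relations are redundant, but in this form they are invariant
  under a rotation of the hexagon and under the exchange of the two stars.
\<close>
definition kashaev_cube ::
  "real \<Rightarrow> real \<Rightarrow> real \<Rightarrow> real \<Rightarrow> real \<Rightarrow> real \<Rightarrow> real \<Rightarrow> real \<Rightarrow> real \<Rightarrow> real \<Rightarrow>
   real \<Rightarrow> real \<Rightarrow> real \<Rightarrow> real \<Rightarrow> bool" where
  "kashaev_cube r a0 a1 a2 b0 b1 b2 X0 X1 X2 s Y0 Y1 Y2 \<longleftrightarrow>
     X0\<^sup>2 = r\<^sup>2 * b0\<^sup>2 + a0\<^sup>2 * a1\<^sup>2 \<and> X1\<^sup>2 = r\<^sup>2 * b1\<^sup>2 + a1\<^sup>2 * a2\<^sup>2 \<and>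
         X2\<^sup>2 = r\<^sup>2 * b2\<^sup>2 + a2\<^sup>2 * a0\<^sup>2 \<and>
     Y0\<^sup>2 = s\<^sup>2 * a1\<^sup>2 + b0\<^sup>2 * b1\<^sup>2 \<and> Y1\<^sup>2 = s\<^sup>2 * a2\<^sup>2 + b1\<^sup>2 * b2\<^sup>2 \<and>
         Y2\<^sup>2 = s\<^sup>2 * a0\<^sup>2 + b2\<^sup>2 * b0\<^sup>2 \<and>
     r\<^sup>2 * Y0 = a1\<^sup>2 * X2 + X0 * X1 \<and> r\<^sup>2 * Y1 = a2\<^sup>2 * X0 + X1 * X2 \<and>
         r\<^sup>2 * Y2 = a0\<^sup>2 * X1 + X2 * X0 \<and>
     s\<^sup>2 * X0 = b0\<^sup>2 * Y1 + Y2 * Y0 \<and> s\<^sup>2 * X1 = b1\<^sup>2 * Y2 + Y0 * Y1 \<and>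
         s\<^sup>2 * X2 = b2\<^sup>2 * Y0 + Y1 * Y2 \<and>
     r^4 * s\<^sup>2 = 2 * (a0\<^sup>2 * a1\<^sup>2 * a2\<^sup>2) + r\<^sup>2 * (a0\<^sup>2 * b1\<^sup>2 + a1\<^sup>2 * b2\<^sup>2 + a2\<^sup>2 * b0\<^sup>2) +
         2 * (X0 * X1 * X2) \<and>
     s^4 * r\<^sup>2 = 2 * (b0\<^sup>2 * b1\<^sup>2 * b2\<^sup>2) + s\<^sup>2 * (a0\<^sup>2 * b1\<^sup>2 + a1\<^sup>2 * b2\<^sup>2 + a2\<^sup>2 * b0\<^sup>2) +
         2 * (Y0 * Y1 * Y2)"

lemma kashaev_cube_rotate:
  "kashaev_cube r a0 a1 a2 b0 b1 b2 X0 X1 X2 s Y0 Y1 Y2 \<Longrightarrow>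
   kashaev_cube r a1 a2 a0 b1 b2 b0 X1 X2 X0 s Y1 Y2 Y0"
  unfolding kashaev_cube_def by (simp add: algebra_simps)

text \<open>
  After the flip the opposite vertices become neighbours of the centre and vice versa, with a shift
  of the indices by one half of a rotation step. Together with the rotation this symmetry generates
  all the instances of the local identities.
\<close>
lemma kashaev_cube_dual:
  "kashaev_cube r a0 a1 a2 b0 b1 b2 X0 X1 X2 s Y0 Y1 Y2 \<Longrightarrow>
   kashaev_cube s b0 b1 b2 a1 a2 a0 Y0 Y1 Y2 r X1 X2 X0"
  unfolding kashaev_cube_def by (simp add: algebra_simps)

context
  fixes h0 h1 h2 h3 h4 h5 :: mark
    and r a0 a1 a2 b0 b1 b2 X0 X1 X2 :: real
begin

private abbreviation "S t0 t1 t2 \<equiv>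
    star_term t0 t1 t2 h0 h1 h2 h3 h4 h5 r a0 a1 a2 b0 b1 b2 X0 X1 X2"
private abbreviation "F t0 t1 t2 m0 m1 m2 \<equiv>
        star_face t0 m0 m1 h2 h1 (r * b0) (a0 * a1) X0 *
        star_face t1 m1 m2 h4 h3 (r * b1) (a1 * a2) X1 *
        star_face t2 m2 m0 h0 h5 (r * b2) (a2 * a0) X2"

text \<open>
  Two of the three faces already reach all the three spokes. If in these faces no strand turns around
  the centre, every spoke is joined to a side of the hexagon, which determines its mark.
\<close>
lemma star_term_turning:
  assumes "t1 \<noteq> Ce" "t2 \<noteq> Ce"
  shows "S t0 t1 t2 = F t0 t1 t2 (if t2 = Nb then h0 else partner h5)
     (if t1 = Nb then h3 else partner h4) (if t1 = Nb then h4 else partner h3)"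
  unfolding star_term_def
  using assms by (intro sum3_single; cases t1; cases t2) (auto dest!: star_face_nonzero)

text \<open>
  If two faces let their strands turn around the centre and the third one has a crossing, then a
  strand crosses itself, which the colours forbid.
\<close>
lemma star_term_self_crossing: "S Ce Ce Cr = 0" "S Ce Cr Ce = 0" "S Cr Ce Ce = 0"
  unfolding star_term_def by (auto simp: star_face_def intro!: sum.neutral)

lemma star_term_Nb_Ce_Ce: "S Nb Ce Ce = F Nb Ce Ce h1 h1 h1"
  unfolding star_term_def by (rule sum3_single) (auto dest!: star_face_nonzero)

lemma star_term_Ce_Nb_Ce: "S Ce Nb Ce = F Ce Nb Ce h3 h3 h3"
  unfolding star_term_def by (rule sum3_single) (auto dest!: star_face_nonzero)

lemma star_term_Ce_Ce_Nb: "S Ce Ce Nb = F Ce Ce Nb h5 h5 h5"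
  unfolding star_term_def by (rule sum3_single) (auto dest!: star_face_nonzero)

lemma colour_neq: "(k :: colour) \<noteq> l \<Longrightarrow> k \<noteq> j \<Longrightarrow> l = j"
  by (cases k; cases l; cases j) auto

text \<open>
  Three pairwise crossing strands would need three colours.
\<close>
lemma star_term_Cr_Cr_Cr: "S Cr Cr Cr = 0"
proof (rule ccontr)
  assume "\<not> ?thesis"
  then have "mark_colour h1 \<noteq> mark_colour h3" "mark_colour h5 \<noteq> mark_colour h3"
    "mark_colour h1 \<noteq> mark_colour h5"
    by (auto simp: star_term_turning dest!: star_face_nonzero)
  then show False using colour_neq by metis
qed

text \<open>
  Here the spokes carry a closed loop. Its mark is free, but its weight depends on the colour only.
\<close>
lemma star_term_Ce_Ce_Ce: "S Ce Ce Ce = 2 * F Ce Ce Ce M0 M0 M0 + 2 * F Ce Ce Ce MA MA MA"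
proof -
  have "(\<Sum>m1\<in>UNIV. \<Sum>m2\<in>UNIV. F Ce Ce Ce m0 m1 m2) = F Ce Ce Ce m0 m0 m0" for m0
    by (cases m0) (simp_all add: star_face_def UNIV_mark)
  then show ?thesis
    unfolding star_term_def by (simp add: UNIV_mark) (simp add: star_face_def)
qed
end

section \<open>The local identities\<close>

text \<open>
  The identity behind \<open>flip_corner_strands\<close> when one of the three strands differs in colour from the
  other two. It is the product of two of the relations for \<open>s\<^sup>2 X0\<close>, \<open>s\<^sup>2 X1\<close> and \<open>s\<^sup>2 X2\<close>.
\<close>
lemma kashaev_cube_product:
  assumes "kashaev_cube r a0 a1 a2 b0 b1 b2 X0 X1 X2 s Y0 Y1 Y2"
  shows "s^4 * (X1 * X2) = s\<^sup>2 * (a0\<^sup>2 * b1\<^sup>2 + a1\<^sup>2 * b2\<^sup>2) * Y1 + s\<^sup>2 * a2\<^sup>2 * (Y0 * Y2)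
    + 2 * (b0\<^sup>2 * b1\<^sup>2 * b2\<^sup>2 * Y1) + 2 * (b1\<^sup>2 * b2\<^sup>2 * (Y0 * Y2))"
proof -
  have sq: "Y0\<^sup>2 = s\<^sup>2 * a1\<^sup>2 + b0\<^sup>2 * b1\<^sup>2" "Y1\<^sup>2 = s\<^sup>2 * a2\<^sup>2 + b1\<^sup>2 * b2\<^sup>2"
    "Y2\<^sup>2 = s\<^sup>2 * a0\<^sup>2 + b2\<^sup>2 * b0\<^sup>2"
    and X: "s\<^sup>2 * X1 = b1\<^sup>2 * Y2 + Y0 * Y1" "s\<^sup>2 * X2 = b2\<^sup>2 * Y0 + Y1 * Y2"
    using assms unfolding kashaev_cube_def by blast+
  have "s^4 * (X1 * X2) = (s\<^sup>2 * X1) * (s\<^sup>2 * X2)"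
    by algebra
  also have "\<dots> = b1\<^sup>2 * b2\<^sup>2 * (Y0 * Y2) + b1\<^sup>2 * Y1 * Y2\<^sup>2 + b2\<^sup>2 * Y1 * Y0\<^sup>2 + Y0 * Y2 * Y1\<^sup>2"
    unfolding X by algebra
  also have "\<dots> = s\<^sup>2 * (a0\<^sup>2 * b1\<^sup>2 + a1\<^sup>2 * b2\<^sup>2) * Y1 + s\<^sup>2 * a2\<^sup>2 * (Y0 * Y2)
    + 2 * (b0\<^sup>2 * b1\<^sup>2 * b2\<^sup>2 * Y1) + 2 * (b1\<^sup>2 * b2\<^sup>2 * (Y0 * Y2))"
    unfolding sq by algebra
  finally show ?thesis .
qed

context
  fixes r a0 a1 a2 b0 b1 b2 X0 X1 X2 s Y0 Y1 Y2 :: real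
  assumes K: "kashaev_cube r a0 a1 a2 b0 b1 b2 X0 X1 X2 s Y0 Y1 Y2"
begin

private abbreviation "L t0 t1 t2 h0 h1 h2 h3 h4 h5 \<equiv>
    star_term t0 t1 t2 h0 h1 h2 h3 h4 h5 r a0 a1 a2 b0 b1 b2 X0 X1 X2"
private abbreviation "R t0 t1 t2 h0 h1 h2 h3 h4 h5 \<equiv>
    star_term t0 t1 t2 h1 h2 h3 h4 h5 h0 s b0 b1 b2 a1 a2 a0 Y0 Y1 Y2"

lemma cube_relations:
  "X0\<^sup>2 = r\<^sup>2 * b0\<^sup>2 + a0\<^sup>2 * a1\<^sup>2" "X1\<^sup>2 = r\<^sup>2 * b1\<^sup>2 + a1\<^sup>2 * a2\<^sup>2"
  "X2\<^sup>2 = r\<^sup>2 * b2\<^sup>2 + a2\<^sup>2 * a0\<^sup>2"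
  "Y0\<^sup>2 = s\<^sup>2 * a1\<^sup>2 + b0\<^sup>2 * b1\<^sup>2" "Y1\<^sup>2 = s\<^sup>2 * a2\<^sup>2 + b1\<^sup>2 * b2\<^sup>2"
  "Y2\<^sup>2 = s\<^sup>2 * a0\<^sup>2 + b2\<^sup>2 * b0\<^sup>2"
  "r\<^sup>2 * Y0 = a1\<^sup>2 * X2 + X0 * X1" "r\<^sup>2 * Y1 = a2\<^sup>2 * X0 + X1 * X2" "r\<^sup>2 * Y2 = a0\<^sup>2 * X1 + X2 * X0"
  "s\<^sup>2 * X0 = b0\<^sup>2 * Y1 + Y2 * Y0" "s\<^sup>2 * X1 = b1\<^sup>2 * Y2 + Y0 * Y1" "s\<^sup>2 * X2 = b2\<^sup>2 * Y0 + Y1 * Y2"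
  "r^4 * s\<^sup>2 = 2 * (a0\<^sup>2 * a1\<^sup>2 * a2\<^sup>2) + r\<^sup>2 * (a0\<^sup>2 * b1\<^sup>2 + a1\<^sup>2 * b2\<^sup>2 + a2\<^sup>2 * b0\<^sup>2) +
      2 * (X0 * X1 * X2)"
  "s^4 * r\<^sup>2 = 2 * (b0\<^sup>2 * b1\<^sup>2 * b2\<^sup>2) + s\<^sup>2 * (a0\<^sup>2 * b1\<^sup>2 + a1\<^sup>2 * b2\<^sup>2 + a2\<^sup>2 * b0\<^sup>2) +
      2 * (Y0 * Y1 * Y2)"
  using K unfolding kashaev_cube_def by blast+

text \<open>
  The abbreviations \<open>L\<close> and \<open>R\<close> stand for the star before and after the flip, and \<open>R_rot\<close> for the
  latter with the hexagon turned by two sides. The sides of the flipped star are shifted by one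
  against those of the original one, since its first neighbour is the vertex between \<open>h1\<close> and \<open>h2\<close>.

  In each of the following lemmas both sides vanish unless the marks on the hexagon fit the pairing,
  and otherwise the weights only depend on the colours of the three strands.

  Two strands crossing a third one leave a single configuration on each side.
\<close>
lemma flip_two_crossings:
  "s^4 * L Cr Cr Nb h0 h1 h2 h3 h4 h5 = r^4 * R Nb Cr Cr h0 h1 h2 h3 h4 h5" (is "?L = ?R")
proof (cases "h0 = partner h2 \<and> h4 = h1 \<and> h3 = partner h5 \<and> mark_colour h2 \<noteq> mark_colour h1 \<and>
    mark_colour h1 \<noteq> mark_colour h5")
  case True
  then have "mark_colour h5 = mark_colour h2" using colour_neq by metis
  with True show ?thesis
    by (simp add: star_term_turning star_face_def power2_eq_square power4_eq_xxxx)
next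
  case False
  have "?L = 0"
    by (rule ccontr) (use False in \<open>auto simp: star_term_turning dest!: star_face_nonzero\<close>)
  moreover have "?R = 0"
    by (rule ccontr) (use False in \<open>auto simp: star_term_turning dest!: star_face_nonzero\<close>)
  ultimately show ?thesis by (simp only:)
qed

text \<open>
  If exactly one pair of strands crosses, the crossing may lie in either of two faces of the flipped
  star. The third strand has the colour of one of the crossing strands, which selects one of
  the relations for \<open>s\<^sup>2 X0\<close> and \<open>s\<^sup>2 X1\<close>.
\<close>
lemma flip_one_crossing:
  "s^4 * L Nb Nb Cr h0 h1 h2 h3 h4 h5 = r^4 * (R Ce Nb Cr h0 h1 h2 h3 h4 h5 +
      R Ce Cr Nb h0 h1 h2 h3 h4 h5)" (is "?L = r^4 * (?R1 + ?R2)")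
proof (cases "h2 = h3 \<and> h4 = partner h0 \<and> h5 = partner h1 \<and> mark_colour h1 \<noteq> mark_colour h0")
  case True
  have *: "s^4 * (r * b0 * X0 * (r * b1)\<^sup>2 * (r * b2 * (a2 * a0))) =
       r^4 * ((b0 * b1)\<^sup>2 * (s * a2 * Y1) * (s * a0 * (b2 * b0)) +
        b0 * b1 * Y0 * (s * a2 * (b1 * b2)) * (s * a0 * Y2))"
    using cube_relations(10) by algebra
  have **: "s^4 * ((r * b0)\<^sup>2 * (r * b1 * X1) * (r * b2 * (a2 * a0))) =
        r^4 * (b0 * b1 * Y0 * (s * a2 * Y1) * (s * a0 * (b2 * b0)) +
         (b0 * b1)\<^sup>2 * (s * a2 * (b1 * b2)) * (s * a0 * Y2))"
    using cube_relations(11) by algebra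
  from True consider "mark_colour h3 = mark_colour h0" | "mark_colour h3 = mark_colour h1"
    using colour_neq by metis
  then show ?thesis
    using * ** True[THEN conjunct2, THEN conjunct2, THEN conjunct2, THEN not_sym] True
    by cases (simp_all add: star_term_turning star_face_def)
next
  case False
  have "?L = 0" "?R1 = 0" "?R2 = 0"
    by (rule ccontr, use False in \<open>auto simp: star_term_turning dest!: star_face_nonzero\<close>)+
  then show ?thesis by simp
qed

private abbreviation "R_rot t0 t1 t2 h0 h1 h2 h3 h4 h5 \<equiv>
    star_term t0 t1 t2 h3 h4 h5 h0 h1 h2 s b1 b2 b0 a2 a0 a1 Y1 Y2 Y0"

text \<open>
  The three strands are parallel. The same pairing arises if the middle strand crosses one of the
  others twice, which their colours have to allow; the marks then change twice, hence not in total.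
  Before the flip the middle strand can only cross one of the outer strands in this way, and after
  the flip only the other one.
\<close>
lemma flip_parallel_strands:
  "s^4 * (L Ce Nb Nb h0 h1 h2 h3 h4 h5 + L Ce Cr Cr h0 h1 h2 h3 h4 h5) = r^4 *
      (R_rot Ce Nb Nb h0 h1 h2 h3 h4 h5 + R_rot Ce Cr Cr h0 h1 h2 h3 h4 h5)" (is "s^4 * (?L1 +
      ?L2) = r^4 * (?R1 + ?R2)")
proof (cases "h3 = h0 \<and> h2 = h1 \<and> h5 = h4")
  case True
  \<comment> \<open>One identity for each distribution of the two colours, up to their exchange.\<close>
  have p1: "s^4 * ((a0 * a1)\<^sup>2 * (r * b1)\<^sup>2 * (r * b2)\<^sup>2) =
       r^4 * ((b1 * b2)\<^sup>2 * (s * a0)\<^sup>2 * (s * a1)\<^sup>2)"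
    by algebra
  have p2: "s^4 *
       ((a0 * a1)\<^sup>2 * (r * b1 * X1) * (r * b2 * X2) +
        a0 * a1 * X0 * (r * b1 * (a1 * a2)) * (r * b2 * (a2 * a0))) =
       r^4 * (b1 * b2 * Y1 * (s * a0)\<^sup>2 * (s * a1)\<^sup>2)"
    using cube_relations(8) by algebra
  have p3: "s^4 * (a0 * a1 * X0 * (r * b1)\<^sup>2 * (r * b2)\<^sup>2) =
       r^4 *
       ((b1 * b2)\<^sup>2 * (s * a0 * Y2) * (s * a1 * Y0) +
        b1 * b2 * Y1 * (s * a0 * (b2 * b0)) * (s * a1 * (b0 * b1)))"
    using cube_relations(10) by algebra
  have p4: "s^4 *
       (a0 * a1 * X0 * (r * b1 * X1) * (r * b2 * X2) +
        (a0 * a1)\<^sup>2 * (r * b1 * (a1 * a2)) * (r * b2 * (a2 * a0))) =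
       r^4 *
       (b1 * b2 * Y1 * (s * a0 * Y2) * (s * a1 * Y0) +
        (b1 * b2)\<^sup>2 * (s * a0 * (b2 * b0)) * (s * a1 * (b0 * b1)))"
    using cube_relations(13,14) by algebra
  show ?thesis
    using p1 p2 p3 p4 True
    by (cases "mark_colour h0"; cases "mark_colour h1"; cases "mark_colour h4")
      (simp_all add: star_term_turning star_face_def)
next
  case False
  have "?L1 = 0" "?L2 = 0" "?R1 = 0" "?R2 = 0"
    by (rule ccontr, use False in \<open>auto simp: star_term_turning dest!: star_face_nonzero\<close>)+
  then show ?thesis by simp
qed

text \<open>
  All the three strands turn around neighbours of the centre. These are the opposite vertices after
  the flip, where either a closed loop surrounds the centre or one of the three strands makes a detour
  around it. For a single colour this is the recurrence itself, read backwards.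
\<close>
lemma flip_corner_strands:
  "s^4 * L Nb Nb Nb h0 h1 h2 h3 h4 h5 =
   r^4 * (R Nb Ce Ce h0 h1 h2 h3 h4 h5 + R Ce Nb Ce h0 h1 h2 h3 h4 h5 + R Ce Ce Nb h0 h1 h2 h3 h4 h5
       + R Ce Ce Ce h0 h1 h2 h3 h4 h5)" (is "s^4 * ?L = r^4 * (?R1 + ?R2 + ?R3 + ?R4)")
proof (cases "h0 = h1 \<and> h2 = h3 \<and> h4 = h5")
  case True
  \<comment> \<open>One identity for each distribution of the two colours, up to their exchange.\<close>
  have p1: "s^4 * ((r * b0)\<^sup>2 * (r * b1)\<^sup>2 * (r * b2)\<^sup>2) =
         r^4 *
         ((s * a1)\<^sup>2 * (b1 * b2)\<^sup>2 * (b2 * b0)\<^sup>2 +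
          (b0 * b1)\<^sup>2 * (s * a2)\<^sup>2 * (b2 * b0)\<^sup>2 +
          (b0 * b1)\<^sup>2 * (b1 * b2)\<^sup>2 * (s * a0)\<^sup>2 +
          (2 * ((b0 * b1)\<^sup>2 * ((b1 * b2)\<^sup>2 * (b2 * b0)\<^sup>2)) +
           2 * (b0 * b1 * Y0 * (b1 * b2 * Y1 * (b2 * b0 * Y2)))))"
    using cube_relations(14) by algebra
  have p2: "s^4 * ((r * b0)\<^sup>2 * (r * b1 * X1) * (r * b2 * X2)) =
        r^4 *
        ((s * a1)\<^sup>2 * (b1 * b2 * Y1) * (b2 * b0)\<^sup>2 +
         b0 * b1 * Y0 * (s * a2)\<^sup>2 * (b2 * b0 * Y2) +
         (b0 * b1)\<^sup>2 * (b1 * b2 * Y1) * (s * a0)\<^sup>2 +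
         (2 * ((b0 * b1)\<^sup>2 * (b1 * b2 * Y1 * (b2 * b0)\<^sup>2)) +
          2 * (b0 * b1 * Y0 * ((b1 * b2)\<^sup>2 * (b2 * b0 * Y2)))))"
    using kashaev_cube_product[OF K] by algebra
  have p3: "s^4 * (r * b0 * X0 * (r * b1 * X1) * (r * b2)\<^sup>2) =
        r^4 *
        ((s * a1)\<^sup>2 * (b1 * b2 * Y1) * (b2 * b0 * Y2) +
         b0 * b1 * Y0 * (s * a2)\<^sup>2 * (b2 * b0)\<^sup>2 +
         b0 * b1 * Y0 * (b1 * b2)\<^sup>2 * (s * a0)\<^sup>2 +
         (2 * (b0 * b1 * Y0 * ((b1 * b2)\<^sup>2 * (b2 * b0)\<^sup>2)) +
          2 * ((b0 * b1)\<^sup>2 * (b1 * b2 * Y1 * (b2 * b0 * Y2)))))"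
    using kashaev_cube_product[OF kashaev_cube_rotate[OF kashaev_cube_rotate[OF K]]] by algebra
  have p4: "s^4 * (r * b0 * X0 * (r * b1)\<^sup>2 * (r * b2 * X2)) =
        r^4 *
        ((s * a1)\<^sup>2 * (b1 * b2)\<^sup>2 * (b2 * b0 * Y2) +
         (b0 * b1)\<^sup>2 * (s * a2)\<^sup>2 * (b2 * b0 * Y2) +
         b0 * b1 * Y0 * (b1 * b2 * Y1) * (s * a0)\<^sup>2 +
         (2 * (b0 * b1 * Y0 * (b1 * b2 * Y1 * (b2 * b0)\<^sup>2)) +
          2 * ((b0 * b1)\<^sup>2 * ((b1 * b2)\<^sup>2 * (b2 * b0 * Y2)))))"
    using kashaev_cube_product[OF kashaev_cube_rotate[OF K]] by algebra
  show ?thesis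
    using p1 p2 p3 p4 True
    by (cases "mark_colour h1"; cases "mark_colour h3"; cases "mark_colour h5")
      (simp_all add: star_term_turning star_term_Nb_Ce_Ce star_term_Ce_Nb_Ce star_term_Ce_Ce_Nb
        star_term_Ce_Ce_Ce star_face_def add.commute[of "2 * _" "2 * _"])
next
  case False
  have "?L = 0" "?R1 = 0" "?R2 = 0" "?R3 = 0"
    by (rule ccontr, use False in \<open>auto simp: star_term_turning star_term_Nb_Ce_Ce
        star_term_Ce_Nb_Ce star_term_Ce_Ce_Nb dest!: star_face_nonzero\<close>)+
  moreover have "?R4 = 0"
    using False by (auto simp: star_term_Ce_Ce_Ce star_face_def)
  ultimately show ?thesis by simp
qed

end

section \<open>The local identity for all pairings\<close>

definition pairing :: "'a \<Rightarrow> 'a \<Rightarrow> 'a \<Rightarrow> 'a \<Rightarrow> 'a \<Rightarrow> 'a \<Rightarrow> 'a rel" where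
  "pairing a b c d e f = {(a, b), (b, a), (c, d), (d, c), (e, f), (f, e)}"

text \<open>
  The ends of the strands, found by following them through the three faces; the arguments
  \<open>d0, ..., d5\<close> are the sides of the hexagon.
\<close>
fun star_pairing :: "turn \<Rightarrow> turn \<Rightarrow> turn \<Rightarrow> 'a \<Rightarrow> 'a \<Rightarrow> 'a \<Rightarrow> 'a \<Rightarrow> 'a \<Rightarrow> 'a \<Rightarrow> 'a rel" where
  "star_pairing Nb Nb Nb d0 d1 d2 d3 d4 d5 = pairing d0 d1 d2 d3 d4 d5"
| "star_pairing Nb Nb Ce d0 d1 d2 d3 d4 d5 = pairing d0 d5 d1 d4 d2 d3"
| "star_pairing Nb Nb Cr d0 d1 d2 d3 d4 d5 = pairing d0 d4 d1 d5 d2 d3"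
| "star_pairing Nb Ce Nb d0 d1 d2 d3 d4 d5 = pairing d0 d1 d2 d5 d3 d4"
| "star_pairing Nb Ce Ce d0 d1 d2 d3 d4 d5 = pairing d0 d5 d1 d2 d3 d4"
| "star_pairing Nb Ce Cr d0 d1 d2 d3 d4 d5 = pairing d0 d2 d1 d5 d3 d4"
| "star_pairing Nb Cr Nb d0 d1 d2 d3 d4 d5 = pairing d0 d1 d2 d4 d3 d5"
| "star_pairing Nb Cr Ce d0 d1 d2 d3 d4 d5 = pairing d0 d5 d1 d3 d2 d4"
| "star_pairing Nb Cr Cr d0 d1 d2 d3 d4 d5 = pairing d0 d3 d1 d5 d2 d4"
| "star_pairing Ce Nb Nb d0 d1 d2 d3 d4 d5 = pairing d0 d3 d1 d2 d4 d5"
| "star_pairing Ce Nb Ce d0 d1 d2 d3 d4 d5 = pairing d0 d5 d1 d2 d3 d4"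
| "star_pairing Ce Nb Cr d0 d1 d2 d3 d4 d5 = pairing d0 d4 d1 d2 d3 d5"
| "star_pairing Ce Ce Nb d0 d1 d2 d3 d4 d5 = pairing d0 d5 d1 d2 d3 d4"
| "star_pairing Ce Ce Ce d0 d1 d2 d3 d4 d5 = pairing d0 d5 d1 d2 d3 d4"
| "star_pairing Ce Ce Cr d0 d1 d2 d3 d4 d5 = pairing d0 d5 d1 d2 d3 d4"
| "star_pairing Ce Cr Nb d0 d1 d2 d3 d4 d5 = pairing d0 d4 d1 d2 d3 d5"
| "star_pairing Ce Cr Ce d0 d1 d2 d3 d4 d5 = pairing d0 d5 d1 d2 d3 d4"
| "star_pairing Ce Cr Cr d0 d1 d2 d3 d4 d5 = pairing d0 d3 d1 d2 d4 d5"
| "star_pairing Cr Nb Nb d0 d1 d2 d3 d4 d5 = pairing d0 d2 d1 d3 d4 d5"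
| "star_pairing Cr Nb Ce d0 d1 d2 d3 d4 d5 = pairing d0 d5 d1 d3 d2 d4"
| "star_pairing Cr Nb Cr d0 d1 d2 d3 d4 d5 = pairing d0 d4 d1 d3 d2 d5"
| "star_pairing Cr Ce Nb d0 d1 d2 d3 d4 d5 = pairing d0 d2 d1 d5 d3 d4"
| "star_pairing Cr Ce Ce d0 d1 d2 d3 d4 d5 = pairing d0 d5 d1 d2 d3 d4"
| "star_pairing Cr Ce Cr d0 d1 d2 d3 d4 d5 = pairing d0 d1 d2 d5 d3 d4"
| "star_pairing Cr Cr Nb d0 d1 d2 d3 d4 d5 = pairing d0 d2 d1 d4 d3 d5"
| "star_pairing Cr Cr Ce d0 d1 d2 d3 d4 d5 = pairing d0 d5 d1 d4 d2 d3"
| "star_pairing Cr Cr Cr d0 d1 d2 d3 d4 d5 = pairing d0 d3 d1 d4 d2 d5"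

text \<open>
  The function \<open>\<beta>\<close> is the factor by which the outside of the hexagon weighs a pairing. The fifteen
  coefficients of its values agree separately.
\<close>
lemma star_sum_flip:
  fixes \<beta> :: "'a rel \<Rightarrow> real"
  assumes K: "kashaev_cube r a0 a1 a2 b0 b1 b2 X0 X1 X2 s Y0 Y1 Y2"
  shows
    "s^4 * (\<Sum>t0\<in>UNIV. \<Sum>t1\<in>UNIV. \<Sum>t2\<in>UNIV. \<beta> (star_pairing t0 t1 t2 d0 d1 d2 d3 d4 d5) *
        star_term t0 t1 t2 h0 h1 h2 h3 h4 h5 r a0 a1 a2 b0 b1 b2 X0 X1 X2) =
     r^4 * (\<Sum>t0\<in>UNIV. \<Sum>t1\<in>UNIV. \<Sum>t2\<in>UNIV. \<beta> (star_pairing t0 t1 t2 d1 d2 d3 d4 d5 d0) *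
        star_term t0 t1 t2 h1 h2 h3 h4 h5 h0 s b0 b1 b2 a1 a2 a0 Y0 Y1 Y2)"
proof -
  define S where "S t0 t1 t2 = star_term t0 t1 t2 h0 h1 h2 h3 h4 h5 r a0 a1 a2 b0 b1 b2 X0 X1 X2"
      for t0 t1 t2
  define S' where "S' t0 t1 t2 = star_term t0 t1 t2 h1 h2 h3 h4 h5 h0 s b0 b1 b2 a1 a2 a0 Y0 Y1
      Y2" for t0 t1 t2
  \<comment> \<open>Rotated instances are expressed by the same two functions,
      so that the local identities add up.\<close>
  have rot:
    "star_term t0 t1 t2 h0 h1 h2 h3 h4 h5 r a0 a1 a2 b0 b1 b2 X0 X1 X2 = S t0 t1 t2"
    "star_term t1 t2 t0 h2 h3 h4 h5 h0 h1 r a1 a2 a0 b1 b2 b0 X1 X2 X0 = S t0 t1 t2"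
    "star_term t2 t0 t1 h4 h5 h0 h1 h2 h3 r a2 a0 a1 b2 b0 b1 X2 X0 X1 = S t0 t1 t2"
    "star_term t0 t1 t2 h1 h2 h3 h4 h5 h0 s b0 b1 b2 a1 a2 a0 Y0 Y1 Y2 = S' t0 t1 t2"
    "star_term t1 t2 t0 h3 h4 h5 h0 h1 h2 s b1 b2 b0 a2 a0 a1 Y1 Y2 Y0 = S' t0 t1 t2"
    "star_term t2 t0 t1 h5 h0 h1 h2 h3 h4 s b2 b0 b1 a0 a1 a2 Y2 Y0 Y1 = S' t0 t1 t2"
    for t0 t1 t2
    unfolding S_def S'_def by (simp_all only: star_term_rotate)
  note K1 = kashaev_cube_rotate[OF K]
  note K2 = kashaev_cube_rotate[OF K1]
  note D = kashaev_cube_dual[OF K]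
  note D1 = kashaev_cube_rotate[OF D]
  note D2 = kashaev_cube_rotate[OF D1]
  have zero: "S Ce Ce Cr = 0" "S Ce Cr Ce = 0" "S Cr Ce Ce = 0" "S Cr Cr Cr = 0"
    "S' Ce Ce Cr = 0" "S' Ce Cr Ce = 0" "S' Cr Ce Ce = 0" "S' Cr Cr Cr = 0"
    by (simp_all only: S_def S'_def star_term_self_crossing star_term_Cr_Cr_Cr)
  note flips = flip_corner_strands[OF K, of h0 h1 h2 h3 h4 h5, unfolded rot]
    flip_corner_strands[OF D, of h1 h2 h3 h4 h5 h0, unfolded rot]
    flip_parallel_strands[OF K, of h0 h1 h2 h3 h4 h5, unfolded rot]
    flip_parallel_strands[OF K1, of h2 h3 h4 h5 h0 h1, unfolded rot]
    flip_parallel_strands[OF K2, of h4 h5 h0 h1 h2 h3, unfolded rot]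
    flip_one_crossing[OF K, of h0 h1 h2 h3 h4 h5, unfolded rot]
    flip_one_crossing[OF K1, of h2 h3 h4 h5 h0 h1, unfolded rot]
    flip_one_crossing[OF K2, of h4 h5 h0 h1 h2 h3, unfolded rot]
    flip_one_crossing[OF D, of h1 h2 h3 h4 h5 h0, unfolded rot]
    flip_one_crossing[OF D1, of h3 h4 h5 h0 h1 h2, unfolded rot]
    flip_one_crossing[OF D2, of h5 h0 h1 h2 h3 h4, unfolded rot]
    flip_two_crossings[OF K, of h0 h1 h2 h3 h4 h5, unfolded rot]
    flip_two_crossings[OF K1, of h2 h3 h4 h5 h0 h1, unfolded rot]
    flip_two_crossings[OF K2, of h4 h5 h0 h1 h2 h3, unfolded rot]
  \<comment> \<open>One identity for each pairing, in the order in which the pairings appear in the sums below.\<close>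
  have f0: "s^4 * (S Nb Nb Nb) = r^4 * (S' Nb Ce Ce + S' Ce Nb Ce + S' Ce Ce Nb + S' Ce Ce Ce +
      S' Ce Ce Cr + S' Ce Cr Ce + S' Cr Ce Ce)"
    using flips zero by (simp add: add_ac)
  have f1: "s^4 * (S Nb Ce Ce + S Ce Nb Ce + S Ce Ce Nb + S Ce Ce Ce + S Ce Ce Cr + S Ce Cr Ce +
      S Cr Ce Ce) = r^4 * (S' Nb Nb Nb)"
    using flips zero by (simp add: add_ac)
  have f2: "s^4 * (S Nb Nb Ce + S Cr Cr Ce) = r^4 * (S' Ce Nb Nb + S' Ce Cr Cr)"
    using flips zero by (simp add: add_ac)
  have f3: "s^4 * (S Nb Ce Nb + S Cr Ce Cr) = r^4 * (S' Nb Nb Ce + S' Cr Cr Ce)"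
    using flips zero by (simp add: add_ac)
  have f4: "s^4 * (S Nb Nb Cr) = r^4 * (S' Ce Nb Cr + S' Ce Cr Nb)"
    using flips zero by (simp add: add_ac)
  have f5: "s^4 * (S Nb Ce Cr + S Cr Ce Nb) = r^4 * (S' Nb Nb Cr)"
    using flips zero by (simp add: add_ac)
  have f6: "s^4 * (S Ce Nb Nb + S Ce Cr Cr) = r^4 * (S' Nb Ce Nb + S' Cr Ce Cr)"
    using flips zero by (simp add: add_ac)
  have f7: "s^4 * (S Cr Nb Nb) = r^4 * (S' Nb Ce Cr + S' Cr Ce Nb)"
    using flips zero by (simp add: add_ac)
  have f8: "s^4 * (S Nb Cr Nb) = r^4 * (S' Nb Cr Ce + S' Cr Nb Ce)"
    using flips zero by (simp add: add_ac)
  have f9: "s^4 * (S Ce Nb Cr + S Ce Cr Nb) = r^4 * (S' Nb Cr Nb)"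
    using flips zero by (simp add: add_ac)
  have f10: "s^4 * (S Nb Cr Ce + S Cr Nb Ce) = r^4 * (S' Cr Nb Nb)"
    using flips zero by (simp add: add_ac)
  have f11: "s^4 * (S Nb Cr Cr) = r^4 * (S' Cr Nb Cr)"
    using flips zero by (simp add: add_ac)
  have f12: "s^4 * (S Cr Cr Nb) = r^4 * (S' Nb Cr Cr)"
    using flips zero by (simp add: add_ac)
  have f13: "s^4 * (S Cr Nb Cr) = r^4 * (S' Cr Cr Nb)"
    using flips zero by (simp add: add_ac)
  have f14: "s^4 * (S Cr Cr Cr) = r^4 * (S' Cr Cr Cr)"
    using flips zero by (simp add: add_ac)
  \<comment> \<open>The sides of the hexagon are listed from \<open>d1\<close> on after the flip.\<close>
  have canonical: "pairing d1 d0 d2 d3 d4 d5 = pairing d0 d1 d2 d3 d4 d5"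
    "pairing d1 d2 d3 d4 d5 d0 = pairing d0 d5 d1 d2 d3 d4"
    "pairing d1 d4 d2 d3 d5 d0 = pairing d0 d5 d1 d4 d2 d3"
    "pairing d1 d0 d2 d5 d3 d4 = pairing d0 d1 d2 d5 d3 d4"
    "pairing d1 d5 d2 d3 d4 d0 = pairing d0 d4 d1 d5 d2 d3"
    "pairing d1 d5 d2 d0 d3 d4 = pairing d0 d2 d1 d5 d3 d4"
    "pairing d1 d2 d3 d0 d4 d5 = pairing d0 d3 d1 d2 d4 d5"
    "pairing d1 d3 d2 d0 d4 d5 = pairing d0 d2 d1 d3 d4 d5"
    "pairing d1 d0 d2 d4 d3 d5 = pairing d0 d1 d2 d4 d3 d5"
    "pairing d1 d2 d3 d5 d4 d0 = pairing d0 d4 d1 d2 d3 d5"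
    "pairing d1 d3 d2 d4 d5 d0 = pairing d0 d5 d1 d3 d2 d4"
    "pairing d1 d5 d2 d4 d3 d0 = pairing d0 d3 d1 d5 d2 d4"
    "pairing d1 d4 d2 d0 d3 d5 = pairing d0 d2 d1 d4 d3 d5"
    "pairing d1 d3 d2 d5 d4 d0 = pairing d0 d4 d1 d3 d2 d5"
    "pairing d1 d4 d2 d5 d3 d0 = pairing d0 d3 d1 d4 d2 d5"
    unfolding pairing_def by auto
  have "?thesis \<longleftrightarrow>
      \<beta> (pairing d0 d1 d2 d3 d4 d5) * (s^4 * (S Nb Nb Nb)) +
      \<beta> (pairing d0 d5 d1 d2 d3 d4) * (s^4 * (S Nb Ce Ce + S Ce Nb Ce + S Ce Ce Nb + S Ce Ce Ce +
          S Ce Ce Cr + S Ce Cr Ce + S Cr Ce Ce)) +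
      \<beta> (pairing d0 d5 d1 d4 d2 d3) * (s^4 * (S Nb Nb Ce + S Cr Cr Ce)) +
      \<beta> (pairing d0 d1 d2 d5 d3 d4) * (s^4 * (S Nb Ce Nb + S Cr Ce Cr)) +
      \<beta> (pairing d0 d4 d1 d5 d2 d3) * (s^4 * (S Nb Nb Cr)) +
      \<beta> (pairing d0 d2 d1 d5 d3 d4) * (s^4 * (S Nb Ce Cr + S Cr Ce Nb)) +
      \<beta> (pairing d0 d3 d1 d2 d4 d5) * (s^4 * (S Ce Nb Nb + S Ce Cr Cr)) +
      \<beta> (pairing d0 d2 d1 d3 d4 d5) * (s^4 * (S Cr Nb Nb)) +
      \<beta> (pairing d0 d1 d2 d4 d3 d5) * (s^4 * (S Nb Cr Nb)) +
      \<beta> (pairing d0 d4 d1 d2 d3 d5) * (s^4 * (S Ce Nb Cr + S Ce Cr Nb)) +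
      \<beta> (pairing d0 d5 d1 d3 d2 d4) * (s^4 * (S Nb Cr Ce + S Cr Nb Ce)) +
      \<beta> (pairing d0 d3 d1 d5 d2 d4) * (s^4 * (S Nb Cr Cr)) +
      \<beta> (pairing d0 d2 d1 d4 d3 d5) * (s^4 * (S Cr Cr Nb)) +
      \<beta> (pairing d0 d4 d1 d3 d2 d5) * (s^4 * (S Cr Nb Cr)) +
      \<beta> (pairing d0 d3 d1 d4 d2 d5) * (s^4 * (S Cr Cr Cr)) =
      \<beta> (pairing d0 d1 d2 d3 d4 d5) * (r^4 * (S' Nb Ce Ce + S' Ce Nb Ce + S' Ce Ce Nb +
          S' Ce Ce Ce + S' Ce Ce Cr + S' Ce Cr Ce + S' Cr Ce Ce)) +
      \<beta> (pairing d0 d5 d1 d2 d3 d4) * (r^4 * (S' Nb Nb Nb)) +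
      \<beta> (pairing d0 d5 d1 d4 d2 d3) * (r^4 * (S' Ce Nb Nb + S' Ce Cr Cr)) +
      \<beta> (pairing d0 d1 d2 d5 d3 d4) * (r^4 * (S' Nb Nb Ce + S' Cr Cr Ce)) +
      \<beta> (pairing d0 d4 d1 d5 d2 d3) * (r^4 * (S' Ce Nb Cr + S' Ce Cr Nb)) +
      \<beta> (pairing d0 d2 d1 d5 d3 d4) * (r^4 * (S' Nb Nb Cr)) +
      \<beta> (pairing d0 d3 d1 d2 d4 d5) * (r^4 * (S' Nb Ce Nb + S' Cr Ce Cr)) +
      \<beta> (pairing d0 d2 d1 d3 d4 d5) * (r^4 * (S' Nb Ce Cr + S' Cr Ce Nb)) +
      \<beta> (pairing d0 d1 d2 d4 d3 d5) * (r^4 * (S' Nb Cr Ce + S' Cr Nb Ce)) +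
      \<beta> (pairing d0 d4 d1 d2 d3 d5) * (r^4 * (S' Nb Cr Nb)) +
      \<beta> (pairing d0 d5 d1 d3 d2 d4) * (r^4 * (S' Cr Nb Nb)) +
      \<beta> (pairing d0 d3 d1 d5 d2 d4) * (r^4 * (S' Cr Nb Cr)) +
      \<beta> (pairing d0 d2 d1 d4 d3 d5) * (r^4 * (S' Nb Cr Cr)) +
      \<beta> (pairing d0 d4 d1 d3 d2 d5) * (r^4 * (S' Cr Cr Nb)) +
      \<beta> (pairing d0 d3 d1 d4 d2 d5) * (r^4 * (S' Cr Cr Cr))"
    unfolding rot by (simp add: UNIV_turn canonical algebra_simps)
  then show ?thesis
    unfolding f0 f1 f2 f3 f4 f5 f6 f7 f8 f9 f10 f11 f12 f13 f14 by (rule iffD2) (rule refl)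
qed

section \<open>The recurrence yields a Kashaev cube\<close>

text \<open>
  The relations for the roots after the flip come from squaring: \<open>(n\<^sub>1 X\<^sub>2 + X\<^sub>0 X\<^sub>1)\<^sup>2\<close> equals
  \<open>g\<^sup>2 (g' n\<^sub>1 + o\<^sub>0 o\<^sub>1)\<close> by the recurrence, and all the quantities are positive. The reverse
  relations follow by inserting these; squaring one of them gives the reverse recurrence.
\<close>
lemma kashaev_cube_sqrt:
  fixes g n0 n1 n2 o0 o1 o2 g' :: real
  assumes pos: "g > 0" "n0 > 0" "n1 > 0" "n2 > 0" "o0 > 0" "o1 > 0" "o2 > 0"
    and g': "g' = kashaev g n0 n1 n2 o0 o2 o1"
  shows "g' > 0"
    and "kashaev_cube (sqrt g) (sqrt n0) (sqrt n1) (sqrt n2) (sqrt o0) (sqrt o1) (sqrt o2)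
      (sqrt (g * o0 + n0 * n1)) (sqrt (g * o1 + n1 * n2)) (sqrt (g * o2 + n2 * n0)) (sqrt g')
      (sqrt (g' * n1 + o0 * o1)) (sqrt (g' * n2 + o1 * o2)) (sqrt (g' * n0 + o2 * o0))"
proof -
  define X0 where "X0 = sqrt (g * o0 + n0 * n1)"
  define X1 where "X1 = sqrt (g * o1 + n1 * n2)"
  define X2 where "X2 = sqrt (g * o2 + n2 * n0)"
  have X: "X0 > 0" "X1 > 0" "X2 > 0" "X0\<^sup>2 = g * o0 + n0 * n1" "X1\<^sup>2 = g * o1 + n1 * n2"
  "X2\<^sup>2 = g * o2 + n2 * n0"
    using pos by (simp_all add: X0_def X1_def X2_def add_pos_pos)
  have rec: "g\<^sup>2 * g' = 2 * (n0 * n1 * n2) + g * (n0 * o1 + n1 * o2 + n2 * o0) + 2 * (X0 * X1 * X2)"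
    using pos unfolding g' kashaev_def Let_def X0_def X1_def X2_def
    by (simp add: mult_ac)
  moreover have "2 * (n0 * n1 * n2) + g * (n0 * o1 + n1 * o2 + n2 * o0) + 2 * (X0 * X1 * X2) > 0"
    using pos X by (simp add: add_pos_pos)
  ultimately show g'_pos: "g' > 0"
    using pos by (metis zero_less_mult_pos zero_less_power)
  \<comment> \<open>Arbitrary letters serve all the three rotations; likewise for the reverse relations below.\<close>
  have Y: "sqrt (g' * a + b * c) = (a * V + U * W) / g"
    if "g > 0" "a * V + U * W > 0" "a > 0"
      "U\<^sup>2 = g * b + a1 * a" "W\<^sup>2 = g * c + a * a2" "V\<^sup>2 = g * d + a2 * a1"
      "g\<^sup>2 * g' = 2 * (a1 * a * a2) + g * (a1 * c + a * d + a2 * b) + 2 * (U * W * V)"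
    for a a1 a2 b c d U V W :: real
  proof (rule real_sqrt_unique)
    have "(a * V + U * W)\<^sup>2 = a\<^sup>2 * V\<^sup>2 + 2 * a * (U * W * V) + U\<^sup>2 * W\<^sup>2"
      by algebra
    also have "\<dots> = g\<^sup>2 * (g' * a + b * c)"
      using that(7) unfolding that(4-6) by algebra
    finally show "((a * V + U * W) / g)\<^sup>2 = g' * a + b * c"
      using \<open>g > 0\<close> by (simp add: power_divide)
  qed (use that in simp)
  define Y0 where "Y0 = sqrt (g' * n1 + o0 * o1)"
  define Y1 where "Y1 = sqrt (g' * n2 + o1 * o2)"
  define Y2 where "Y2 = sqrt (g' * n0 + o2 * o0)"
  have "Y0 = (n1 * X2 + X0 * X1) / g" unfolding Y0_def
    by (rule Y[of n1 X2 X0 X1 o0 n0 o1 n2 o2]) (use pos X rec in \<open>simp_all add: add_pos_pos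
        mult_ac\<close>)
  moreover have "Y1 = (n2 * X0 + X1 * X2) / g" unfolding Y1_def
    by (rule Y[of n2 X0 X1 X2 o1 n1 o2 n0 o0]) (use pos X rec in \<open>simp_all add: add_pos_pos
        algebra_simps\<close>)
  moreover have "Y2 = (n0 * X1 + X2 * X0) / g" unfolding Y2_def
    by (rule Y[of n0 X1 X2 X0 o2 n2 o0 n1 o1]) (use pos X rec in \<open>simp_all add: add_pos_pos
        algebra_simps\<close>)
  ultimately have gY: "g * Y0 = n1 * X2 + X0 * X1" "g * Y1 = n2 * X0 + X1 * X2"
      "g * Y2 = n0 * X1 + X2 * X0"
    using pos by simp_all
  have Y2: "Y0\<^sup>2 = g' * n1 + o0 * o1" "Y1\<^sup>2 = g' * n2 + o1 * o2" "Y2\<^sup>2 = g' * n0 + o2 * o0"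
    using pos g'_pos by (simp_all add: Y0_def Y1_def Y2_def)
  have g'X: "g' * V = d * Y + Y' * Y''"
    if "g * Y = a * V + U * W" "g * Y' = a2 * U + W * V" "g * Y'' = a1 * W + V * U"
      "U\<^sup>2 = g * b + a1 * a" "W\<^sup>2 = g * c + a * a2" "V\<^sup>2 = g * d + a2 * a1"
      "g\<^sup>2 * g' = 2 * (a1 * a * a2) + g * (a1 * c + a * d + a2 * b) + 2 * (U * W * V)"
    for a a1 a2 b c d U V W Y Y' Y'' :: real
  proof -
    have "g\<^sup>2 * (d * Y + Y' * Y'') = g * d * (g * Y) + (g * Y') * (g * Y'')"
      by algebra
    also have "\<dots> = g\<^sup>2 * (g' * V)"
      using that(4-7) unfolding that(1-3) by algebra
    finally show ?thesis using pos by simp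
  qed
  have X': "g' * X2 = o2 * Y0 + Y1 * Y2"
    by (rule g'X[of Y0 n1 X2 X0 X1 Y1 n2 Y2 n0 o0 o1 o2])
        (use gY X rec in \<open>simp_all add: algebra_simps\<close>)
  moreover have "g' * X0 = o0 * Y1 + Y2 * Y0"
    by (rule g'X[of Y1 n2 X0 X1 X2 Y2 n0 Y0 n1 o1 o2 o0])
        (use gY X rec in \<open>simp_all add: algebra_simps\<close>)
  moreover have "g' * X1 = o1 * Y2 + Y0 * Y1"
    by (rule g'X[of Y2 n0 X1 X2 X0 Y0 n1 Y1 n2 o2 o0 o1])
        (use gY X rec in \<open>simp_all add: algebra_simps\<close>)
  moreover have "g'\<^sup>2 * g = 2 * (o0 * o1 * o2) + g' * (n0 * o1 + n1 * o2 + n2 * o0) +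
      2 * (Y0 * Y1 * Y2)"
  proof -
    have "(g' * X2)\<^sup>2 = o2\<^sup>2 * Y0\<^sup>2 + 2 * o2 * (Y0 * Y1 * Y2) + Y1\<^sup>2 * Y2\<^sup>2"
      unfolding X' by algebra
    then have "o2 * (g'\<^sup>2 * g) = o2 * (2 * (o0 * o1 * o2) + g' * (n0 * o1 + n1 * o2 + n2 * o0) +
        2 * (Y0 * Y1 * Y2))"
      using X(6) unfolding Y2 by algebra
    then show ?thesis using pos by simp
  qed
  moreover have "sqrt g ^ 4 = g\<^sup>2" "sqrt g' ^ 4 = g'\<^sup>2"
    using pos g'_pos by (simp_all add: power4_eq_xxxx power2_eq_square mult.assoc[symmetric])
  ultimately show "kashaev_cube (sqrt g) (sqrt n0) (sqrt n1) (sqrt n2) (sqrt o0) (sqrt o1) (sqrt o2)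
      (sqrt (g * o0 + n0 * n1)) (sqrt (g * o1 + n1 * n2)) (sqrt (g * o2 + n2 * n0)) (sqrt g')
      (sqrt (g' * n1 + o0 * o1)) (sqrt (g' * n2 + o1 * o2)) (sqrt (g' * n0 + o2 * o0))"
    unfolding X0_def[symmetric] X1_def[symmetric] X2_def[symmetric]
      Y0_def[symmetric] Y1_def[symmetric] Y2_def[symmetric] kashaev_cube_def
    using pos g'_pos gY X Y2 rec by (simp add: mult_ac)
qed

section \<open>Maps with a star\<close>

text \<open>
  The three faces at the centre and, below, the position of a side in such a face: its boundary walk
  enters the centre, leaves it, goes away to the opposite vertex and comes back from there.
\<close>
datatype sector = Sec0 | Sec1 | Sec2

fun nxt :: "sector \<Rightarrow> sector" where
  "nxt Sec0 = Sec1" | "nxt Sec1 = Sec2" | "nxt Sec2 = Sec0"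

datatype side = Enter | Leave | Away | Back

fun next_side :: "side \<Rightarrow> side" where
  "next_side Enter = Leave" | "next_side Leave = Away" | "next_side Away = Back"
      | "next_side Back = Enter"

text \<open>
  The other end of the strand that starts at a given side.
\<close>
fun joined :: "turn \<Rightarrow> side \<Rightarrow> side" where
  "joined Nb Enter = Back" | "joined Nb Back = Enter" | "joined Nb Leave = Away"
      | "joined Nb Away = Leave"
| "joined Ce Enter = Leave" | "joined Ce Leave = Enter" | "joined Ce Away = Back"
    | "joined Ce Back = Away"
| "joined Cr Enter = Away" | "joined Cr Away = Enter" | "joined Cr Leave = Back"
    | "joined Cr Back = Leave"

lemma UNIV_sector: "(UNIV :: sector set) = {Sec0, Sec1, Sec2}"
  using sector.exhaust by auto

instance sector :: finite
  by standard (simp add: UNIV_sector)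

lemma UNIV_side: "(UNIV :: side set) = {Enter, Leave, Away, Back}"
  using side.exhaust by auto

instance side :: finite
  by standard (simp add: UNIV_side)

lemma nxt_neq [simp]: "nxt k \<noteq> k" "k \<noteq> nxt k"
  by (cases k; simp)+

lemma nxt_eq_iff [simp]: "nxt k = nxt l \<longleftrightarrow> k = l"
  by (cases k; cases l) auto

lemma nxt_nxt_nxt [simp]: "nxt (nxt (nxt k)) = k"
  by (cases k) auto

lemma ex_nxt: "\<exists>l. k = nxt l"
  using nxt.simps by (cases k) metis+

lemma joined_joined [simp]: "joined t (joined t s) = s" and joined_neq [simp]: "joined t s \<noteq> s"
  by (cases t; cases s; simp)+

text \<open>
  The sector with index \<open>k\<close> lies between the neighbours \<open>nb k\<close> and \<open>nb (nxt k)\<close> of the centre, and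
  \<open>opp k\<close> is opposite to the centre. Consecutive sectors share the spoke on which \<open>Leave\<close> of the first
  and \<open>Enter\<close> of the second are the two sides.
\<close>
fun sector_side :: "'v \<Rightarrow> (sector \<Rightarrow> 'v) \<Rightarrow> (sector \<Rightarrow> 'v) \<Rightarrow> sector \<times> side \<Rightarrow> 'v dart" where
  "sector_side x nb opp (k, Enter) = (nb k, x)"
| "sector_side x nb opp (k, Leave) = (x, nb (nxt k))"
| "sector_side x nb opp (k, Away) = (nb (nxt k), opp k)"
| "sector_side x nb opp (k, Back) = (opp k, nb k)"

text \<open>
  A map with three internal faces around a vertex \<open>x\<close> of degree 3, reduced to what the decomposition
  of the partition function needs: the internal faces partition the internal darts. Both the given
  map and the flipped one are instances.
\<close>
locale star =
  fixes M :: "'v quad_map" and x :: 'v and nb opp :: "sector \<Rightarrow> 'v"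
  assumes finite_darts: "finite (darts M)"
    and face_closed: "\<And>f d. f \<in> internal_faces M \<Longrightarrow> d \<in> f \<Longrightarrow> fnext M d \<in> f"
    and Union_faces: "\<Union>(internal_faces M) = internal_darts M"
    and face_unique: "\<And>f f' d. f \<in> internal_faces M \<Longrightarrow> f' \<in> internal_faces M \<Longrightarrow> d \<in> f \<Longrightarrow> d \<in> f'
        \<Longrightarrow> f = f'"
    and inj_nb: "inj nb" and inj_opp: "inj opp"
    and distinct: "nb k \<noteq> opp l" "nb k \<noteq> x" "opp k \<noteq> x"
    and sector_face: "\<And>k. range (\<lambda>s. sector_side x nb opp (k, s)) \<in> internal_faces M"
    and centre_darts: "\<And>u v. (u, v) \<in> darts M \<Longrightarrow> u = x \<or> v = x \<Longrightarrow>
      (\<exists>k. (u, v) = (nb k, x) \<or> (u, v) = (x, nb k))"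
begin

abbreviation sd :: "sector \<Rightarrow> side \<Rightarrow> 'v dart" where "sd k s \<equiv> sector_side x nb opp (k, s)"

definition sector_of :: "sector \<Rightarrow> 'v dart set" where "sector_of k = range (sd k)"

definition outside_faces :: "'v dart set set" where
  "outside_faces = internal_faces M - range sector_of"

definition outside_darts :: "'v dart set" where
  "outside_darts = {d \<in> internal_darts M. fst d \<noteq> x \<and> snd d \<noteq> x}"

lemma distinct' [simp]: "nb k \<noteq> opp l" "nb k \<noteq> x" "opp k \<noteq> x" "opp l \<noteq> nb k" "x \<noteq> nb k" "x \<noteq> opp k"
  "nb k = nb l \<longleftrightarrow> k = l" "opp k = opp l \<longleftrightarrow> k = l"
  using distinct inj_nb inj_opp by (auto simp: inj_eq dest: not_sym)

lemma sd_eq_iff [simp]: "sd k s = sd l r \<longleftrightarrow> k = l \<and> s = r"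
  by (cases s; cases r) auto

lemma inj_sector_side: "inj (sector_side x nb opp)"
  by (auto simp: inj_def)

lemma sector_of_internal [simp]: "sector_of k \<in> internal_faces M"
  using sector_face unfolding sector_of_def .

lemma sd_in_sector_of [simp]: "sd k s \<in> sector_of l \<longleftrightarrow> k = l"
  by (auto simp: sector_of_def)

lemma inj_sector_of: "inj sector_of"
  by (metis injI sd_in_sector_of)

lemma internal_face_subset: "f \<in> internal_faces M \<Longrightarrow> f \<subseteq> internal_darts M"
  using Union_faces by auto

lemma sd_internal [simp]: "sd k s \<in> internal_darts M"
  using internal_face_subset[OF sector_of_internal[of k]] by auto

lemma fnext_sd [simp]: "fnext M (sd k s) = sd k (next_side s)"
proof -
  have "fnext M (sd k s) \<in> sector_of k"
    by (rule face_closed) auto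
  then obtain r where r: "fnext M (sd k s) = sd k r"
    by (auto simp: sector_of_def)
  have "fst (fnext M (sd k s)) = snd (sd k s)"
    by (simp add: fnext_def)
  with r have "r = next_side s"
    by (cases s; cases r) auto
  with r show ?thesis by simp
qed

lemma swap_sd [simp]: "prod.swap (sd k Leave) = sd (nxt k) Enter" "prod.swap (sd (nxt k) Enter)
    = sd k Leave"
  by auto

lemma sd_outside [simp]: "sd k s \<in> outside_darts \<longleftrightarrow> s = Away \<or> s = Back"
  using sd_internal[of k s] by (cases s) (auto simp: outside_darts_def simp del: sd_internal)

text \<open>
  Every internal dart either belongs to a face that the flip keeps, and then avoids the centre, or it
  is a side of one of the three sectors.
\<close>
lemma internal_cases:
  assumes "d \<in> internal_darts M"
  obtains (outside) "d \<in> \<Union>outside_faces" "d \<in> outside_darts" "\<And>k s. d \<noteq> sd k s"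
    | (sector) k s where "d = sd k s" "d \<notin> \<Union>outside_faces"
proof (cases "\<exists>k s. d = sd k s")
  case True
  then obtain k s where d: "d = sd k s" by auto
  then have "d \<notin> \<Union>outside_faces"
    using face_unique[OF _ sector_of_internal[of k], of _ d] by (auto simp: outside_faces_def)
  with d show ?thesis using sector by blast
next
  case False
  obtain f where f: "f \<in> internal_faces M" "d \<in> f"
    using assms Union_faces by auto
  have "f \<notin> range sector_of"
    using False f by (auto simp: sector_of_def)
  then have "d \<in> \<Union>outside_faces"
    using f by (auto simp: outside_faces_def)
  moreover have "d \<in> outside_darts"
  proof (rule ccontr)
    assume "d \<notin> outside_darts"
    then have "fst d = x \<or> snd d = x" using assms by (auto simp: outside_darts_def)
    then obtain k where "d = (nb k, x) \<or> d = (x, nb k)"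
      using centre_darts[of "fst d" "snd d"] assms unfolding internal_darts_def by auto
    moreover obtain l where "k = nxt l" using ex_nxt by blast
    ultimately have "d = sd k Enter \<or> d = sd l Leave" by auto
    with False show False by blast
  qed
  ultimately show ?thesis using outside False by blast
qed

lemma sd_notin_outside_faces [simp]: "f \<in> outside_faces \<Longrightarrow> sd k s \<notin> f"
  using internal_cases[OF sd_internal[of k s]] by (metis UnionI)

lemma outside_faces_subset: "\<Union>outside_faces \<subseteq> outside_darts"
  using internal_cases internal_face_subset by (metis DiffD1 UnionE outside_faces_def subsetD
      subsetI)

lemma outside_subset: "outside_darts \<subseteq> internal_darts M"
  by (auto simp: outside_darts_def)

lemma outside_face_closed: "f \<in> outside_faces \<Longrightarrow> d \<in> f \<Longrightarrow> fnext M d \<in> f"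
  using face_closed by (auto simp: outside_faces_def)

lemma swap_outside: "d \<in> outside_darts \<Longrightarrow> prod.swap d \<in> internal_darts M \<longleftrightarrow>
    prod.swap d \<in> outside_darts"
  by (auto simp: outside_darts_def)

lemma internal_faces_eq: "internal_faces M = outside_faces \<union> range sector_of"
  and outside_faces_disjoint: "outside_faces \<inter> range sector_of = {}"
  by (auto simp: outside_faces_def)

lemma internal_darts_eq: "internal_darts M = \<Union>outside_faces \<union> range (sector_side x nb opp)"
proof
  show "internal_darts M \<subseteq> \<Union>outside_faces \<union> range (sector_side x nb opp)"
  proof
    fix d assume "d \<in> internal_darts M"
    then show "d \<in> \<Union>outside_faces \<union> range (sector_side x nb opp)"
      by (cases rule: internal_cases) blast+
  qed
  show "\<Union>outside_faces \<union> range (sector_side x nb opp) \<subseteq> internal_darts M"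
    using outside_faces_subset outside_subset by auto
qed

lemma boundary_darts_subset: "boundary_darts M \<subseteq> outside_darts"
proof
  fix d assume d: "d \<in> boundary_darts M"
  then have i: "d \<in> internal_darts M" and o: "prod.swap d \<notin> internal_darts M"
    by (auto simp: boundary_darts_def internal_darts_def)
  show "d \<in> outside_darts"
  proof (rule internal_cases[OF i])
    fix k s assume eq: "d = sd k s"
    obtain l where "k = nxt l" using ex_nxt by blast
    then have "s \<noteq> Enter" "s \<noteq> Leave"
      using o eq by (metis sd_internal swap_sd(2)) (metis eq o sd_internal swap_sd(1))
    then have "s = Away \<or> s = Back" by (cases s) auto
    then show ?thesis unfolding eq by (simp only: sd_outside)
  qed auto
qed

lemma finite_outside_faces: "finite outside_faces" and finite_outside_darts: "finite outside_darts"
proof -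
  have "finite (internal_darts M)" using finite_darts by (simp add: internal_darts_def)
  then show "finite outside_darts" by (simp add: outside_darts_def)
  have "outside_faces \<subseteq> Pow (internal_darts M)"
    using internal_face_subset by (auto simp: outside_faces_def)
  then show "finite outside_faces"
    using \<open>finite (internal_darts M)\<close> by (meson finite_Pow_iff finite_subset)
qed

end

section \<open>Strands through the star\<close>

text \<open>
  On the spokes this is the passage from one sector to the next, with indices counted modulo 3. The
  sides of the hexagon are left fixed, so that following a strand stops there.
\<close>
fun across :: "sector \<times> side \<Rightarrow> sector \<times> side" where
  "across (k, Leave) = (nxt k, Enter)"
| "across (k, Enter) = (nxt (nxt k), Leave)"
| "across (k, Away) = (k, Away)"
| "across (k, Back) = (k, Back)"

definition on_hexagon :: "sector \<times> side \<Rightarrow> bool" where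
  "on_hexagon a \<longleftrightarrow> snd a = Away \<or> snd a = Back"

fun trace :: "(sector \<Rightarrow> turn) \<Rightarrow> nat \<Rightarrow> sector \<times> side \<Rightarrow> sector \<times> side" where
  "trace t 0 a = a"
| "trace t (Suc i) (k, s) =
     (if on_hexagon (k, joined (t k) s) then (k, joined (t k) s) else trace t i (across (k,
         joined (t k) s)))"

definition hexagon_pairing :: "(sector \<times> side \<Rightarrow> 'a) \<Rightarrow> (sector \<Rightarrow> turn) \<Rightarrow> 'a rel" where
  "hexagon_pairing D t = star_pairing (t Sec0) (t Sec1) (t Sec2)
     (D (Sec2, Away)) (D (Sec0, Back)) (D (Sec0, Away)) (D (Sec1, Back)) (D (Sec1, Away))
         (D (Sec2, Back))"

text \<open>
  Assigns to a spoke a side of the hexagon on the same strand. A closed loop around the centre has no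
  such side; as its spokes are connected to each other only, they may be sent to any common value.
  After three sectors a strand has reached the hexagon or its starting point.
\<close>
definition retract :: "(sector \<Rightarrow> turn) \<Rightarrow> sector \<times> side \<Rightarrow> sector \<times> side" where
  "retract t a = (if on_hexagon a then a
     else let b = trace t 3 (if snd a = Enter then a else across a)
       in if on_hexagon b then b else (Sec0, Away))"

lemma hexagon_pairing_image: "hexagon_pairing D t = map_prod D D ` hexagon_pairing id t"
  unfolding hexagon_pairing_def
  by (cases "t Sec0"; cases "t Sec1"; cases "t Sec2") (simp_all add: pairing_def)

text \<open>
  A strand that comes in from the hexagon traverses at most four sectors: it may turn around the centre
  once and leave from the sector in which it started.
\<close>
lemma hexagon_pairing_trace: "(a, b) \<in> hexagon_pairing id t \<Longrightarrow> b = trace t 4 a"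
  unfolding hexagon_pairing_def
  by (cases "t Sec0"; cases "t Sec1"; cases "t Sec2")
    (auto simp: pairing_def on_hexagon_def eval_nat_numeral)

text \<open>
  The two sides joined in a sector are sent to the same end of a strand or to its two ends.
\<close>
lemma retract_joined:
  "retract t (k, s) = retract t (k, joined (t k) s) \<or>
   (retract t (k, s), retract t (k, joined (t k) s)) \<in> hexagon_pairing id t"
  by (cases "t Sec0"; cases "t Sec1"; cases "t Sec2"; cases k; cases s)
    (simp_all add: hexagon_pairing_def pairing_def retract_def on_hexagon_def eval_nat_numeral)

lemma retract_across: "retract t (across a) = retract t a"
  by (cases a rule: across.cases) (auto simp: retract_def on_hexagon_def)

lemma in_graph_iff: "(d, e) \<in> {(d, f d) | d. P d} \<longleftrightarrow> P d \<and> e = f d"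
  by (simp only: mem_Collect_eq prod.inject) metis

context star
begin

abbreviation D :: "sector \<times> side \<Rightarrow> 'v dart" where "D \<equiv> sector_side x nb opp"

lemma swap_D: "\<not> on_hexagon a \<Longrightarrow> prod.swap (D a) = D (across a)"
  by (cases a rule: across.cases) (auto simp: on_hexagon_def)

definition outside_rel :: "('v dart \<Rightarrow> 'v dart) \<Rightarrow> 'v dart rel" where
  "outside_rel q = {(d, q d) | d. d \<in> \<Union>outside_faces} \<union>
     {(d, prod.swap d) | d. d \<in> outside_darts \<and> prod.swap d \<in> outside_darts}"

lemma strand_rel_iff:
  "(d, e) \<in> strand_rel M p \<longleftrightarrow>
     d \<in> internal_darts M \<and> (e = p d \<or> e = prod.swap d \<and> e \<in> internal_darts M)"
  unfolding strand_rel_def Un_iff in_graph_iff by metis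

lemma outside_rel_iff:
  "(d, e) \<in> outside_rel q \<longleftrightarrow>
     d \<in> \<Union>outside_faces \<and> e = q d \<or> d \<in> outside_darts \<and> e = prod.swap d \<and> e \<in> outside_darts"
  unfolding outside_rel_def Un_iff in_graph_iff by metis

text \<open>
  Following a strand inside the star is a walk along \<open>strand_rel\<close>.
\<close>
lemma trace_strand_rel:
  assumes p: "\<And>k s. p (D (k, s)) = D (k, joined (t k) s)"
  shows "(D a, D (trace t i a)) \<in> (strand_rel M p)\<^sup>*"
proof (induction i arbitrary: a)
  case (Suc i)
  obtain k s where a: "a = (k, s)" by fastforce
  define b where "b = (k, joined (t k) s)"
  have "p (D a) = D b" unfolding a b_def by (rule p)
  then have 1: "(D a, D b) \<in> strand_rel M p"
    unfolding strand_rel_iff a using sd_internal[of k s] by simp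
  show ?case
  proof (cases "on_hexagon b")
    case True
    then have "trace t (Suc i) a = b" unfolding a b_def by (simp only: trace.simps if_True)
    then show ?thesis using r_into_rtrancl[OF 1] by (simp only:)
  next
    case False
    then have "trace t (Suc i) a = trace t i (across b)" unfolding a b_def
        by (simp only: trace.simps if_False)
    moreover have "(D b, D (across b)) \<in> strand_rel M p"
      using sd_internal[of k "joined (t k) s"] sd_internal[of "fst (across b)" "snd (across b)"]
      unfolding strand_rel_iff b_def[symmetric] swap_D[OF False]
          by (simp only: prod.collapse simp_thms)
    ultimately show ?thesis
      using converse_rtrancl_into_rtrancl[OF 1 converse_rtrancl_into_rtrancl[OF _ Suc.IH[of
          "across b"]]]
      by (simp only:)
  qed
qed simp

text \<open>
  Seen from outside, the star may be replaced by the pairing of its hexagon. A path in the outer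
  relation and the pairing expands to a path along the strands. Conversely, the map \<open>\<rho>\<close>, which
  contracts the star to its hexagon, sends each step along a strand to a path of the reduced relation.
\<close>
lemma strand_connections:
  assumes q: "\<And>d. d \<in> \<Union>outside_faces \<Longrightarrow> p d = q d" "\<And>d. d \<in> \<Union>outside_faces \<Longrightarrow> q d \<in> \<Union>outside_faces"
    and p: "\<And>k s. p (D (k, s)) = D (k, joined (t k) s)"
    and ab: "a \<in> outside_darts" "b \<in> outside_darts"
  shows "(a, b) \<in> (strand_rel M p)\<^sup>* \<longleftrightarrow> (a, b) \<in> (outside_rel q \<union> hexagon_pairing D t)\<^sup>*"
proof
  have "outside_rel q \<union> hexagon_pairing D t \<subseteq> (strand_rel M p)\<^sup>*"
  proof (rule Un_least; rule subrelI)
    fix d e assume "(d, e) \<in> outside_rel q"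
    then have "(d, e) \<in> strand_rel M p"
      unfolding outside_rel_iff strand_rel_iff
      using q(1)[of d] subsetD[OF outside_faces_subset, of d] subsetD[OF outside_subset] by metis
    then show "(d, e) \<in> (strand_rel M p)\<^sup>*" by (rule r_into_rtrancl)
  next
    fix d e assume "(d, e) \<in> hexagon_pairing D t"
    then obtain ab where ab: "ab \<in> hexagon_pairing id t" "(d, e) = map_prod D D ab"
      unfolding hexagon_pairing_image[of D] by (rule imageE)
    obtain a b where "ab = (a, b)" by (rule prod.exhaust)
    with ab have "d = D a \<and> e = D b" and pair: "(a, b) \<in> hexagon_pairing id t"
      by (simp_all only: map_prod_simp prod.inject)
    then show "(d, e) \<in> (strand_rel M p)\<^sup>*"
      using trace_strand_rel[of p t a 4, OF p] unfolding hexagon_pairing_trace[OF pair]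
          by (simp only:)
  qed
  from rtrancl_subset_rtrancl[OF this]
  show "(a, b) \<in> (outside_rel q \<union> hexagon_pairing D t)\<^sup>* \<Longrightarrow> (a, b) \<in> (strand_rel M p)\<^sup>*"
    by (rule subsetD)
next
  define \<rho> where "\<rho> d = (if d \<in> range D then D (retract t (inv D d)) else d)" for d
  have \<rho>D: "\<rho> (D a) = D (retract t a)" for a
    by (simp add: \<rho>_def inv_f_f[OF inj_sector_side])
  have \<rho>_outside: "\<rho> d = d" if "d \<in> outside_darts" for d
  proof (cases "d \<in> range D")
    case True
    then obtain k s where d: "d = D (k, s)" by auto
    with that have "on_hexagon (k, s)" by (simp add: on_hexagon_def del: sector_side.simps)
    then show ?thesis unfolding d \<rho>D by (simp add: retract_def)
  qed (simp add: \<rho>_def)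
  have step: "(\<rho> d, \<rho> e) \<in> (outside_rel q \<union> hexagon_pairing D t)\<^sup>*"
      if de: "(d, e) \<in> strand_rel M p" for d e
  proof -
    from de consider "d \<in> internal_darts M" "e = p d" | "d \<in> internal_darts M" "e = prod.swap d"
        "e \<in> internal_darts M"
      unfolding strand_rel_iff by blast
    then show ?thesis
    proof cases
      case 1
      show ?thesis
      proof (rule internal_cases[OF 1(1)])
        assume d: "d \<in> \<Union>outside_faces"
        then have "(d, e) \<in> outside_rel q"
          using q(1) 1(2) unfolding outside_rel_iff by simp
        moreover have "d \<in> outside_darts" "e \<in> outside_darts"
          using q(2)[OF d] 1(2) q(1)[OF d] d outside_faces_subset by (simp_all only: subset_iff)
        ultimately show ?thesis by (simp only: \<rho>_outside r_into_rtrancl Un_iff simp_thms)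
      next
        fix k s assume d: "d = sd k s"
        show ?thesis
          using retract_joined[of t k s]
        proof
          assume "(retract t (k, s), retract t (k, joined (t k) s)) \<in> hexagon_pairing id t"
          then have "(D (retract t (k, s)), D (retract t (k, joined (t k) s)))
              \<in> hexagon_pairing D t"
            unfolding hexagon_pairing_image[of D] by (rule rev_image_eqI) simp
          then show ?thesis unfolding 1(2) d p \<rho>D by (blast intro: r_into_rtrancl)
        qed (simp only: 1(2) d p \<rho>D rtrancl.rtrancl_refl)
      qed
    next
      case 2
      show ?thesis
      proof (cases "d \<in> outside_darts")
        case True
        then have "e \<in> outside_darts"
          using 2 swap_outside by simp
        moreover from this have "(d, e) \<in> outside_rel q"
          using 2(2) True unfolding outside_rel_iff by simp
        ultimately show ?thesis using True by (simp only: \<rho>_outside r_into_rtrancl Un_iff simp_thms)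
      next
        case False
        then obtain k s where d: "d = D (k, s)" "\<not> on_hexagon (k, s)"
          using internal_cases[OF 2(1)] unfolding on_hexagon_def snd_conv
          by (metis outside_faces_subset sd_outside subsetD)
        then show ?thesis
          unfolding 2(2) d(1) swap_D[OF d(2)] \<rho>D by (simp add: retract_across)
      qed
    qed
  qed
  assume "(a, b) \<in> (strand_rel M p)\<^sup>*"
  then have "(\<rho> a, \<rho> b) \<in> (outside_rel q \<union> hexagon_pairing D t)\<^sup>*"
    by (induction rule: rtrancl_induct) (simp, meson step rtrancl_trans)
  then show "(a, b) \<in> (outside_rel q \<union> hexagon_pairing D t)\<^sup>*"
    using ab by (simp add: \<rho>_outside)
qed

end

section \<open>Configurations on a sector\<close>

lemma local_config_cong:
  assumes "\<And>d. d \<in> f \<Longrightarrow> fnext M d \<in> f"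
    and pc: "\<And>d. d \<in> f \<Longrightarrow> p d = p' d" "\<And>d. d \<in> f \<Longrightarrow> c d = c' d"
  shows "local_config M f p c \<longleftrightarrow> local_config M f p' c'"
proof -
  have "local_config M f p' c'" if "local_config M f p c" "\<And>d. d \<in> f \<Longrightarrow> p d = p' d" "\<And>d. d \<in> f
      \<Longrightarrow> c d = c' d"
    for p p' :: "'a dart \<Rightarrow> 'a dart" and c c'
    unfolding local_config_def
  proof (intro ballI)
    fix d assume d: "d \<in> f"
    then have "p d \<in> f" "p d \<noteq> d" "p (p d) = d" "c (p d) = c d" "p d = fnext M (fnext M d)
        \<Longrightarrow> c (fnext M d) \<noteq> c d"
      using that(1) unfolding local_config_def by blast+
    then show "p' d \<in> f \<and> p' d \<noteq> d \<and> p' (p' d) = d \<and> c' (p' d) = c' d \<and>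
        (p' d = fnext M (fnext M d) \<longrightarrow> c' (fnext M d) \<noteq> c' d)"
      using that(2,3) d assms(1)[OF d] by metis
  qed
  from this[of p c p' c'] this[of p' c' p c] pc show ?thesis by metis
qed

lemma face_weight_cong:
  assumes "f \<noteq> {}" and closed: "\<And>d. d \<in> f \<Longrightarrow> fnext M d \<in> f"
    and M: "\<And>d. d \<in> f \<Longrightarrow> fnext M' d = fnext M d" and g: "\<And>d. d \<in> f \<Longrightarrow> g (fst d) = g' (fst d)"
    and pc: "\<And>d. d \<in> f \<Longrightarrow> p d = p' d" "\<And>d. d \<in> f \<Longrightarrow> c d = c' d"
  shows "face_weight M g p c f = face_weight M' g' p' c' f"
proof -
  define d where "d = (SOME d. d \<in> f)"
  have "d \<in> f" using assms(1) unfolding d_def by (meson ex_in_conv someI_ex)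
  then show ?thesis
    unfolding face_weight_def d_def[symmetric] weight_from_def local_type_def
    by (simp add: M pc g closed)
qed

text \<open>
  The rule by which a mark changes along the strand at the dart \<open>d\<close>.
\<close>
definition marking_at :: "'v quad_map \<Rightarrow> ('v dart \<Rightarrow> 'v dart) \<Rightarrow> ('v dart \<Rightarrow> mark) \<Rightarrow> 'v dart \<Rightarrow>
    bool" where
  "marking_at M p m d \<longleftrightarrow> (if p d = fnext M (fnext M d) then m (p d) \<noteq> m d else m (p d) = m d)"

text \<open>
  The fixed-point-free involutions of the four sides are the three kinds of turns.
\<close>
lemma involution_joined:
  assumes f: "\<And>s. f s \<noteq> s" "\<And>s. f (f s) = s"
  shows "f s = joined (if f Enter = Back then Nb else if f Enter = Leave then Ce else Cr) s"
proof -
  consider "f Enter = Leave" | "f Enter = Away" | "f Enter = Back"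
    using f(1)[of Enter] by (cases "f Enter") simp_all
  then show ?thesis
  proof cases
    case 1
    then have "f Leave = Enter" using f(2)[of Enter] by simp
    moreover have "f Away = Back"
      using 1 calculation f(1)[of Away] f(2)[of Away] by (cases "f Away") simp_all
    moreover from this have "f Back = Away" using f(2)[of Away] by simp
    ultimately show ?thesis using 1 by (cases s) simp_all
  next
    case 2
    then have "f Away = Enter" using f(2)[of Enter] by simp
    moreover have "f Leave = Back"
      using 2 calculation f(1)[of Leave] f(2)[of Leave] by (cases "f Leave") simp_all
    moreover from this have "f Back = Leave" using f(2)[of Leave] by simp
    ultimately show ?thesis using 2 by (cases s) simp_all
  next
    case 3
    then have "f Back = Enter" using f(2)[of Enter] by simp
    moreover have "f Leave = Away"
      using 3 calculation f(1)[of Leave] f(2)[of Leave] by (cases "f Leave") simp_all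
    moreover from this have "f Away = Leave" using f(2)[of Leave] by simp
    ultimately show ?thesis using 3 by (cases s) simp_all
  qed
qed

declare sector_side.simps [simp del]

context star
begin

definition turn_of :: "('v dart \<Rightarrow> 'v dart) \<Rightarrow> sector \<Rightarrow> turn" where
  "turn_of p k = (if p (sd k Enter) = sd k Back then Nb else if p (sd k Enter)
      = sd k Leave then Ce else Cr)"

abbreviation sector_compatible :: "turn \<Rightarrow> ('v dart \<Rightarrow> mark) \<Rightarrow> sector \<Rightarrow> bool" where
  "sector_compatible t m k \<equiv> marks_match t (m (sd k Enter)) (m (sd k Leave)) (m (sd k Away))
      (m (sd k Back))"

lemma sector_configI:
  assumes p: "\<And>s. p (sd k s) = sd k (joined t s)"
    and compat: "sector_compatible t m k"
  shows "local_config M (sector_of k) p (mark_colour \<circ> m)" and "marking_at M p m (sd k s)"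
proof -
  have "m (sd k (joined t s)) \<noteq> m (sd k s) \<and> mark_colour (m (sd k (joined t s)))
      = mark_colour (m (sd k s)) \<and>
      mark_colour (m (sd k (next_side s))) \<noteq> mark_colour (m (sd k s))"
    if "joined t s = next_side (next_side s)" for s
    using that compat by (cases t; cases s) (auto simp: partner_iff)
  moreover have "m (sd k (joined t s)) = m (sd k s)" if "joined t s \<noteq> next_side (next_side s)" for s
    using that compat by (cases t; cases s) auto
  ultimately show "local_config M (sector_of k) p (mark_colour \<circ> m)" "marking_at M p m (sd k s)"
    unfolding local_config_def marking_at_def sector_of_def by (auto simp: p) metis
qed

text \<open>
  A configuration on a sector together with its marks is the same as a kind of turn with matching
  marks; the previous lemma is the converse.
\<close>
lemma sector_configD:
  assumes lc: "local_config M (sector_of k) p (mark_colour \<circ> m)"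
      and m: "\<And>s. marking_at M p m (sd k s)"
  shows "p (sd k s) = sd k (joined (turn_of p k) s)" and "sector_compatible (turn_of p k) m k"
proof -
  have "\<exists>r. p (sd k s) = sd k r" for s
    using lc unfolding local_config_def sector_of_def by blast
  then obtain f where f: "\<And>s. p (sd k s) = sd k (f s)" by metis
  have *: "f s \<noteq> s" "f (f s) = s" "mark_colour (m (sd k (f s))) = mark_colour (m (sd k s))"
      "f s = next_side (next_side s) \<Longrightarrow> mark_colour (m (sd k (next_side s)))
          \<noteq> mark_colour (m (sd k s))" for s
    using lc unfolding local_config_def sector_of_def by (auto simp: f)
  have t: "turn_of p k = (if f Enter = Back then Nb else if f Enter = Leave then Ce else Cr)"
    by (simp add: turn_of_def f)
  have fs: "f s = joined (turn_of p k) s" for s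
    unfolding t by (rule involution_joined[OF *(1,2)])
  then show "p (sd k s) = sd k (joined (turn_of p k) s)" by (simp add: f)
  have m': "if f s = next_side (next_side s) then m (sd k (f s)) \<noteq> m (sd k s) else m (sd k (f s))
      = m (sd k s)" for s
    using m[of s] by (simp only: marking_at_def f sd_eq_iff fnext_sd simp_thms)
  show "sector_compatible (turn_of p k) m k"
    using m'[of Enter] m'[of Leave] m'[of Away] *(3)[of Enter] *(3)[of Leave] *(4)[of Enter]
        *(4)[of Leave]
    unfolding fs by (cases "turn_of p k") (simp_all add: partner_iff)
qed

lemma sector_of_eq: "sector_of k = {sd k s, sd k (next_side s), sd k (next_side (next_side s)),
    sd k (next_side (next_side (next_side s)))}"
  unfolding sector_of_def by (cases s) (simp_all add: UNIV_side insert_commute)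

lemma card_sector_of: "card (sector_of k) = 4"
  by (subst sector_of_eq[of k Enter]) simp

text \<open>
  The weight of a face does not depend on the side from which it is read off, so it may be computed at
  the side that enters the centre.
\<close>
lemma sector_weight:
  assumes lc: "local_config M (sector_of k) p c"
  shows "face_weight M g p c (sector_of k) = weight_from M g p c (sd k Enter)"
proof -
  have step: "weight_from M g p c (sd k (next_side s)) = weight_from M g p c (sd k s)" for s
  proof -
    have "fnext M (fnext M (fnext M (fnext M (sd k s)))) = sd k s"
      by (cases s) simp_all
    then show ?thesis
      using weight_from_fnext[of "sector_of k" "sd k s" M p c g] sector_of_eq[of k s]
          card_sector_of[of k] lc
      by simp
  qed
  have "weight_from M g p c (sd k s) = weight_from M g p c (sd k Enter)" for s
    using step[of Enter] step[of Leave] step[of Away] by (cases s) simp_all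
  moreover have "(SOME d. d \<in> sector_of k) \<in> range (sd k)"
    unfolding sector_of_def by (rule someI_ex) blast
  ultimately show ?thesis
    unfolding face_weight_def by fastforce
qed

lemma sector_weight_eq:
  assumes p: "\<And>s. p (sd k s) = sd k (joined t s)"
    and compat: "sector_compatible t m k"
    and g: "g x > 0" "\<And>k. g (nb k) > 0" "\<And>k. g (opp k) > 0"
  shows "face_weight M g p (mark_colour \<circ> m) (sector_of k) =
    star_face t (m (sd k Enter)) (m (sd k Leave)) (m (sd k Away)) (m (sd k Back))
      (sqrt (g x) * sqrt (g (opp k))) (sqrt (g (nb k)) * sqrt (g (nb (nxt k))))
      (sqrt (g x * g (opp k) + g (nb k) * g (nb (nxt k))))"
proof -
  have c: "(mark_colour \<circ> m) d = mark_colour (m d)" for d by simp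
  have sq: "(sqrt a * sqrt b)\<^sup>2 = a * b" if "a > 0" "b > 0" for a b :: real
    using that by (simp add: power_mult_distrib)
  have "weight_from M g p (mark_colour \<circ> m) (sd k Enter) =
      type_weight (local_type M p (mark_colour \<circ> m) (sd k Enter)) (g (nb k)) (g x)
          (g (nb (nxt k))) (g (opp k))"
    unfolding weight_from_def fnext_sd Let_def by (simp add: sector_side.simps)
  moreover have "local_type M p (mark_colour \<circ> m) (sd k Enter) =
    (case t of Cr \<Rightarrow> Type5
      | Ce \<Rightarrow> (if mark_colour (m (sd k Enter)) = mark_colour (m (sd k Away)) then Type1 else Type3)
      | Nb \<Rightarrow> (if mark_colour (m (sd k Enter)) = mark_colour (m (sd k Away)) then Type2 else Type4))"
    unfolding local_type_def by (cases t) (simp_all add: p c)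
  ultimately show ?thesis
    unfolding sector_weight[OF sector_configI(1)[OF p compat]] star_face_def
    using compat g by (cases t) (simp_all add: sq real_sqrt_mult add.commute mult_ac)
qed

end

section \<open>Decomposition of the partition function\<close>

text \<open>
  The marks determine the colours, and agreement of the marks across an edge implies agreement of the
  colours.
\<close>
lemma marked_loop_configs_iff:
  assumes union: "\<Union>(internal_faces M) = internal_darts M"
    and closed: "\<forall>f\<in>internal_faces M. \<forall>d\<in>f. fnext M d \<in> f"
  shows "(p, c, m) \<in> marked_loop_configs M bc \<longleftrightarrow>
     p \<in> internal_darts M \<rightarrow>\<^sub>E internal_darts M \<and> c = restrict (mark_colour \<circ> m) (internal_darts M) \<and>
     m \<in> internal_darts M \<rightarrow>\<^sub>E UNIV \<and>
     (\<forall>d\<in>internal_darts M. prod.swap d \<in> internal_darts M \<longrightarrow> m (prod.swap d) = m d) \<and>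
     (\<forall>f\<in>internal_faces M. local_config M f p (mark_colour \<circ> m)) \<and>
     (\<forall>d\<in>internal_darts M. marking_at M p m d) \<and>
     bc (restrict (mark_colour \<circ> m) (boundary_darts M)) (boundary_connections M p)"
    (is "_ \<longleftrightarrow> ?R")
proof -
  let ?I = "internal_darts M"
  have lc: "local_config M f p (restrict (mark_colour \<circ> m) ?I) \<longleftrightarrow>
      local_config M f p (mark_colour \<circ> m)"
    if "f \<in> internal_faces M" for f
  proof (rule local_config_cong)
    show "restrict (mark_colour \<circ> m) ?I d = (mark_colour \<circ> m) d" if "d \<in> f" for d
      using that \<open>f \<in> internal_faces M\<close> union by auto
  qed (use closed that in auto)
  have bd: "boundary_colours M (restrict (mark_colour \<circ> m) ?I) = restrict (mark_colour \<circ> m)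
      (boundary_darts M)"
    unfolding boundary_colours_def by (rule restrict_ext) (simp add: boundary_darts_def)
  have c: "c = restrict (mark_colour \<circ> m) ?I" if "c \<in> ?I \<rightarrow>\<^sub>E UNIV" "\<And>d. d \<in> ?I
      \<Longrightarrow> mark_colour (m d) = c d"
    using that by (intro extensionalityI[of c ?I]) (auto simp: PiE_def)
  show ?thesis
  proof
    assume L: "(p, c, m) \<in> marked_loop_configs M bc"
    then have c': "c = restrict (mark_colour \<circ> m) ?I"
      by (intro c) (auto simp: marked_loop_configs_def loop_configs_def is_marking_def)
    show ?R
      using L lc bd unfolding marked_loop_configs_def loop_configs_def is_marking_def
          marking_at_def c'
      by auto
  next
    assume R: ?R
    then have c': "c = restrict (mark_colour \<circ> m) ?I" by blast
    show "(p, c, m) \<in> marked_loop_configs M bc"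
      using R lc bd unfolding marked_loop_configs_def loop_configs_def is_marking_def
          marking_at_def c'
      by auto
  qed
qed

context star
begin

lemma faces_closed: "\<forall>f\<in>internal_faces M. \<forall>d\<in>f. fnext M d \<in> f"
  using face_closed by blast

text \<open>
  The part of a marked configuration that the flip does not touch. The strands are recorded in the
  outside faces only, but the marks also on the sides of the hexagon.
\<close>
definition outside_configs :: "(('v dart \<Rightarrow> 'v dart) \<times> ('v dart \<Rightarrow> mark)) set" where
  "outside_configs = {(q, m).
     q \<in> \<Union>outside_faces \<rightarrow>\<^sub>E \<Union>outside_faces \<and> m \<in> outside_darts \<rightarrow>\<^sub>E UNIV \<and>
     (\<forall>d\<in>outside_darts. prod.swap d \<in> outside_darts \<longrightarrow> m (prod.swap d) = m d) \<and>
     (\<forall>f\<in>outside_faces. local_config M f q (mark_colour \<circ> m)) \<and>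
     (\<forall>d\<in>\<Union>outside_faces. marking_at M q m d)}"

definition glue :: "('v dart \<Rightarrow> 'v dart) \<Rightarrow> (sector \<Rightarrow> turn) \<Rightarrow> 'v dart \<Rightarrow> 'v dart" where
  "glue q t d = (if d \<in> \<Union>outside_faces then q d
     else if d \<in> range D then (case inv D d of (k, s) \<Rightarrow> D (k, joined (t k) s)) else undefined)"

definition glue_marks :: "('v dart \<Rightarrow> mark) \<Rightarrow> (sector \<Rightarrow> mark) \<Rightarrow> 'v dart \<Rightarrow> mark" where
  "glue_marks m \<nu> d = (if d \<in> outside_darts then m d
     else if d \<in> range D then (case inv D d of (k, s) \<Rightarrow>
         \<nu> (if s = Enter then k else nxt k)) else undefined)"

lemma glue_outside: "d \<in> \<Union>outside_faces \<Longrightarrow> glue q t d = q d"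
  by (simp add: glue_def)

lemma glue_sd: "glue q t (sd k s) = sd k (joined (t k) s)"
proof -
  have "sd k s \<notin> \<Union>outside_faces" by auto
  then show ?thesis by (simp add: glue_def inv_f_f[OF inj_sector_side])
qed

lemma glue_marks_outside: "d \<in> outside_darts \<Longrightarrow> glue_marks m \<nu> d = m d"
  by (simp add: glue_marks_def)

lemma glue_marks_sd:
  "glue_marks m \<nu> (sd k Enter) = \<nu> k" "glue_marks m \<nu> (sd k Leave) = \<nu> (nxt k)"
  "glue_marks m \<nu> (sd k Away) = m (sd k Away)" "glue_marks m \<nu> (sd k Back) = m (sd k Back)"
  by (simp_all add: glue_marks_def inv_f_f[OF inj_sector_side])

lemma glue_extensional: "d \<notin> internal_darts M \<Longrightarrow> glue q t d = undefined"
  and glue_marks_extensional: "d \<notin> internal_darts M \<Longrightarrow> glue_marks m \<nu> d = undefined"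
  unfolding glue_def glue_marks_def internal_darts_eq using outside_subset internal_darts_eq by auto

lemma marking_at_outside:
  assumes "d \<in> \<Union>outside_faces" "\<And>d. d \<in> \<Union>outside_faces \<Longrightarrow> p d = q d"
    "\<And>d. d \<in> outside_darts \<Longrightarrow> m d = m' d" "q d \<in> \<Union>outside_faces"
  shows "marking_at M p m d \<longleftrightarrow> marking_at M q m' d"
proof -
  have "d \<in> outside_darts" "q d \<in> outside_darts" using assms(1,4) outside_faces_subset by auto
  then have "p d = q d" "m d = m' d" "m (q d) = m' (q d)" using assms by blast+
  then show ?thesis unfolding marking_at_def by (simp only:)
qed

lemma local_config_outside:
  assumes "f \<in> outside_faces" "\<And>d. d \<in> \<Union>outside_faces \<Longrightarrow> p d = q d"
    "\<And>d. d \<in> outside_darts \<Longrightarrow> m d = m' d"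
  shows "local_config M f p (mark_colour \<circ> m) \<longleftrightarrow> local_config M f q (mark_colour \<circ> m')"
proof (rule local_config_cong)
  fix d assume "d \<in> f"
  then have "d \<in> \<Union>outside_faces" "d \<in> outside_darts" using assms(1) outside_faces_subset by auto
  then show "p d = q d" "(mark_colour \<circ> m) d = (mark_colour \<circ> m') d" using assms by simp_all
qed (rule outside_face_closed[OF assms(1)])

lemma sector_of_ball: "(\<forall>f\<in>internal_faces M. P f) \<longleftrightarrow> (\<forall>f\<in>outside_faces. P f) \<and> (\<forall>k. P (sector_of k))"
  unfolding internal_faces_eq by auto

lemma internal_darts_ball: "(\<forall>d\<in>internal_darts M. P d) \<longleftrightarrow> (\<forall>d\<in>\<Union>outside_faces. P d) \<and>
    (\<forall>k s. P (sd k s))"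
  unfolding internal_darts_eq by auto

text \<open>
  Two sides of an edge have the same mark: this is a condition on the outside and one for each spoke.
\<close>
lemma swap_ball:
  "(\<forall>d\<in>internal_darts M. prod.swap d \<in> internal_darts M \<longrightarrow> m (prod.swap d) = m d) \<longleftrightarrow>
   (\<forall>d\<in>outside_darts. prod.swap d \<in> outside_darts \<longrightarrow> m (prod.swap d) = m d) \<and>
   (\<forall>k. m (sd k Leave) = m (sd (nxt k) Enter))"
  (is "?L \<longleftrightarrow> ?R")
proof
  assume ?L
  then show ?R using outside_subset sd_internal swap_sd(1) by (metis subsetD)
next
  assume R: ?R
  show ?L
  proof (intro ballI impI)
    fix d assume d: "d \<in> internal_darts M" "prod.swap d \<in> internal_darts M"
    show "m (prod.swap d) = m d"
    proof (cases "d \<in> outside_darts")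
      case True
      then show ?thesis using R d swap_outside by blast
    next
      case False
      then obtain k s where ks: "d = sd k s" using internal_cases[OF d(1)] by metis
      with False have "s = Enter \<or> s = Leave" by (cases s) simp_all
      moreover obtain l where "k = nxt l" using ex_nxt by blast
      ultimately show ?thesis using R ks swap_sd by metis
    qed
  qed
qed

definition compatible_with :: "('v dart \<Rightarrow> mark) \<Rightarrow> (sector \<Rightarrow> turn) \<Rightarrow> (sector \<Rightarrow> mark) \<Rightarrow> bool" where
  "compatible_with m t \<nu> \<longleftrightarrow>
     (\<forall>k. marks_match (t k) (\<nu> k) (\<nu> (nxt k)) (m (sd k Away)) (m (sd k Back)))"

definition outside_connections :: "('v dart \<Rightarrow> 'v dart) \<Rightarrow> 'v dart rel \<Rightarrow> 'v dart rel" where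
  "outside_connections q \<pi> = {(d, e). d \<in> boundary_darts M \<and> e \<in> boundary_darts M \<and> d \<noteq> e \<and>
     (d, e) \<in> (outside_rel q \<union> \<pi>)\<^sup>*}"

lemma boundary_connections_eq:
  assumes "\<And>d. d \<in> \<Union>outside_faces \<Longrightarrow> p d = q d" "\<And>d. d \<in> \<Union>outside_faces \<Longrightarrow> q d \<in> \<Union>outside_faces"
    and "\<And>k s. p (sd k s) = sd k (joined (t k) s)"
  shows "boundary_connections M p = outside_connections q (hexagon_pairing D t)"
  unfolding boundary_connections_def outside_connections_def
  using strand_connections[OF assms] boundary_darts_subset by blast

text \<open>
  A configuration corresponds to its outside together with a turn for each sector and a mark for each
  spoke. The map \<open>glue_config\<close> is the inverse.
\<close>
definition split_config where
  "split_config = (\<lambda>(p, c :: 'v dart \<Rightarrow> colour, m). ((restrict p (\<Union>outside_faces),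
      restrict m outside_darts),
     (turn_of p, \<lambda>k. m (sd k Enter))))"

definition glue_config where
  "glue_config = (\<lambda>((q, m), (t, \<nu>)). (glue q t,
     restrict (mark_colour \<circ> glue_marks m \<nu>) (internal_darts M), glue_marks m \<nu>))"

definition split_configs where
  "split_configs bc = {((q, m), (t, \<nu>)). (q, m) \<in> outside_configs \<and> compatible_with m t \<nu> \<and>
     bc (restrict (mark_colour \<circ> m) (boundary_darts M))
         (outside_connections q (hexagon_pairing D t))}"

lemma turn_of_joined: "(\<And>s. p (sd k s) = sd k (joined t s)) \<Longrightarrow> turn_of p k = t"
  unfolding turn_of_def by (cases t) simp_all

lemma split_config_glue_config:
  assumes "a \<in> split_configs bc"
  shows "split_config (glue_config a) = a" and "glue_config a \<in> marked_loop_configs M bc"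
proof -
  obtain q m t \<nu> where a: "a = ((q, m), (t, \<nu>))" by (metis surj_pair)
  have out: "(q, m) \<in> outside_configs" and compat: "compatible_with m t \<nu>"
    and bc: "bc (restrict (mark_colour \<circ> m) (boundary_darts M))
        (outside_connections q (hexagon_pairing D t))"
    using assms unfolding a split_configs_def by auto
  have q: "q \<in> \<Union>outside_faces \<rightarrow>\<^sub>E \<Union>outside_faces" and m: "m \<in> outside_darts \<rightarrow>\<^sub>E UNIV"
    using out unfolding outside_configs_def by auto
  have q_in: "q d \<in> \<Union>outside_faces" if "d \<in> \<Union>outside_faces" for d
    using q that by (rule PiE_mem)
  define p where "p = glue q t"
  define n where "n = glue_marks m \<nu>"
  have p: "p d = q d" if "d \<in> \<Union>outside_faces" for d
    using that unfolding p_def by (rule glue_outside)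
  have p': "p (sd k s) = sd k (joined (t k) s)" for k s
    unfolding p_def by (rule glue_sd)
  have n: "n d = m d" if "d \<in> outside_darts" for d
    using that unfolding n_def by (rule glue_marks_outside)
  have n': "n (sd k Enter) = \<nu> k" "n (sd k Leave) = \<nu> (nxt k)" "n (sd k Away) = m (sd k Away)"
      "n (sd k Back) = m (sd k Back)" for k
    unfolding n_def by (rule glue_marks_sd)+
  have sc: "sector_compatible (t k) n k" for k
    using compat unfolding compatible_with_def n' by blast
  have "restrict p (\<Union>outside_faces) = q"
    using q p by (intro extensionalityI[of _ "\<Union>outside_faces"]) (auto simp: PiE_def)
  moreover have "restrict n outside_darts = m"
    using m n by (intro extensionalityI[of _ outside_darts]) (auto simp: PiE_def)
  moreover have "turn_of p = t"
    using turn_of_joined[OF p'] by blast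
  ultimately show "split_config (glue_config a) = a"
    unfolding a split_config_def glue_config_def by (simp add: p_def[symmetric] n_def[symmetric] n')
  have "p \<in> internal_darts M \<rightarrow>\<^sub>E internal_darts M"
  proof (rule PiE_I)
    fix d assume d: "d \<in> internal_darts M"
    show "p d \<in> internal_darts M"
      using d
    proof (cases rule: internal_cases)
      case outside
      then show ?thesis using p[of d] q_in[of d] unfolding internal_darts_eq by simp
    next
      case (sector k s)
      then show ?thesis using p'[of k s] sd_internal by simp
    qed
  qed (simp add: p_def glue_extensional)
  moreover have "n \<in> internal_darts M \<rightarrow>\<^sub>E UNIV"
    by (rule PiE_I) (simp_all add: n_def glue_marks_extensional)
  moreover have "\<forall>d\<in>internal_darts M. prod.swap d \<in> internal_darts M \<longrightarrow> n (prod.swap d) = n d"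
    unfolding swap_ball n' using out n unfolding outside_configs_def by simp
  moreover have "\<forall>f\<in>internal_faces M. local_config M f p (mark_colour \<circ> n)"
    unfolding sector_of_ball
    using out local_config_outside[OF _ p n] sector_configI(1)[OF p' sc]
    unfolding outside_configs_def by simp
  moreover have "\<forall>d\<in>internal_darts M. marking_at M p n d"
    unfolding internal_darts_ball
    using out marking_at_outside[OF _ p n q_in] sector_configI(2)[OF p' sc]
    unfolding outside_configs_def by simp
  moreover have "restrict (mark_colour \<circ> n) (boundary_darts M) = restrict (mark_colour \<circ> m)
      (boundary_darts M)"
    using boundary_darts_subset n by (intro restrict_ext) auto
  moreover have "boundary_connections M p = outside_connections q (hexagon_pairing D t)"
    by (rule boundary_connections_eq[OF p q_in p'])
  moreover have "glue_config a = (p, restrict (mark_colour \<circ> n) (internal_darts M), n)"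
    unfolding a glue_config_def prod.case p_def n_def ..
  ultimately show "glue_config a \<in> marked_loop_configs M bc"
    using bc by (simp only: marked_loop_configs_iff[OF Union_faces faces_closed] simp_thms)
qed

lemma glue_config_split_config:
  assumes "b \<in> marked_loop_configs M bc"
  shows "glue_config (split_config b) = b" and "split_config b \<in> split_configs bc"
proof -
  obtain p c n where b: "b = (p, c, n)" by (metis surj_pair)
  define q where "q = restrict p (\<Union>outside_faces)"
  define m where "m = restrict n outside_darts"
  define t where "t = turn_of p"
  define \<nu> where "\<nu> k = n (sd k Enter)" for k
  have split: "split_config b = ((q, m), (t, \<nu>))"
    unfolding b split_config_def prod.case q_def m_def t_def \<nu>_def ..
  note R = assms[unfolded b marked_loop_configs_iff[OF Union_faces faces_closed]]
  have p_ext: "p \<in> internal_darts M \<rightarrow>\<^sub>E internal_darts M" and c: "c = restrict (mark_colour \<circ> n)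
      (internal_darts M)"
    and n_ext: "n \<in> internal_darts M \<rightarrow>\<^sub>E UNIV"
    and swap: "\<forall>d\<in>internal_darts M. prod.swap d \<in> internal_darts M \<longrightarrow> n (prod.swap d) = n d"
    and lc: "\<And>f. f \<in> internal_faces M \<Longrightarrow> local_config M f p (mark_colour \<circ> n)"
    and mk: "\<And>d. d \<in> internal_darts M \<Longrightarrow> marking_at M p n d"
    and bc: "bc (restrict (mark_colour \<circ> n) (boundary_darts M)) (boundary_connections M p)"
    using R by blast+
  have p: "p d = q d" if "d \<in> \<Union>outside_faces" for d
    using that unfolding q_def by (simp only: restrict_apply if_True)
  have n: "n d = m d" if "d \<in> outside_darts" for d
    using that unfolding m_def by simp
  have p': "p (sd k s) = sd k (joined (t k) s)" and sc: "sector_compatible (t k) n k" for k s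
    using sector_configD[OF lc[OF sector_of_internal] mk[OF sd_internal]] unfolding t_def by blast+
  have n': "n (sd k Leave) = \<nu> (nxt k)" "n (sd k Enter) = \<nu> k" for k
    using swap unfolding swap_ball \<nu>_def by blast+
  have q_in: "q d \<in> \<Union>outside_faces" if "d \<in> \<Union>outside_faces" for d
  proof -
    obtain f where f: "f \<in> outside_faces" "d \<in> f" using \<open>d \<in> _\<close> by blast
    then have "p d \<in> f" using lc[of f] unfolding local_config_def outside_faces_def by blast
    then show ?thesis using f p[OF that] by (metis UnionI)
  qed
  have "glue q t d = p d" for d
  proof (cases "d \<in> internal_darts M")
    case True
    then show ?thesis
    proof (cases rule: internal_cases)
      case outside
      then show ?thesis by (simp only: glue_outside p)
    next
      case (sector k s)
      then show ?thesis by (simp only: glue_sd p')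
    qed
  next
    case False
    then show ?thesis using PiE_arb[OF p_ext False] by (simp only: glue_extensional[OF False])
  qed
  moreover have "glue_marks m \<nu> d = n d" for d
  proof (cases "d \<in> internal_darts M")
    case True
    then show ?thesis
    proof (cases rule: internal_cases)
      case outside
      then show ?thesis by (simp only: glue_marks_outside n)
    next
      case (sector k s)
      then show ?thesis using n[of "sd k s"] by (cases s) (simp_all add: glue_marks_sd n')
    qed
  next
    case False
    then show ?thesis using PiE_arb[OF n_ext False] by (simp only: glue_marks_extensional[OF False])
  qed
  ultimately have "glue q t = p" "glue_marks m \<nu> = n" by blast+
  then show "glue_config (split_config b) = b"
    unfolding split glue_config_def prod.case by (simp only: b c)
  have "q \<in> \<Union>outside_faces \<rightarrow>\<^sub>E \<Union>outside_faces"
    by (rule PiE_I, rule q_in) (simp_all add: q_def)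
  moreover have "m \<in> outside_darts \<rightarrow>\<^sub>E UNIV"
    by (rule PiE_I) (simp_all add: m_def)
  moreover have "\<forall>d\<in>outside_darts. prod.swap d \<in> outside_darts \<longrightarrow> m (prod.swap d) = m d"
    using swap n unfolding swap_ball by simp
  moreover have "\<forall>f\<in>outside_faces. local_config M f q (mark_colour \<circ> m)"
  proof
    fix f assume f: "f \<in> outside_faces"
    then have "f \<in> internal_faces M" by (simp add: outside_faces_def)
    then show "local_config M f q (mark_colour \<circ> m)"
      using lc local_config_outside[OF f, of p q n m] p n by blast
  qed
  moreover have "\<forall>d\<in>\<Union>outside_faces. marking_at M q m d"
  proof
    fix d assume d: "d \<in> \<Union>outside_faces"
    then have "d \<in> internal_darts M" using outside_faces_subset outside_subset by blast
    then show "marking_at M q m d"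
      using mk marking_at_outside[OF d, of p q n m] p n q_in[OF d] by blast
  qed
  moreover have "compatible_with m t \<nu>"
    unfolding compatible_with_def
  proof
    fix k
    show "marks_match (t k) (\<nu> k) (\<nu> (nxt k)) (m (sd k Away)) (m (sd k Back))"
      using sc[of k] n[of "sd k Away"] n[of "sd k Back"] by (simp add: n')
  qed
  moreover have "restrict (mark_colour \<circ> n) (boundary_darts M) = restrict (mark_colour \<circ> m)
      (boundary_darts M)"
    using boundary_darts_subset n by (intro restrict_ext) auto
  moreover have "boundary_connections M p = outside_connections q (hexagon_pairing D t)"
    by (rule boundary_connections_eq[OF p q_in p'])
  ultimately show "split_config b \<in> split_configs bc"
    using bc unfolding split split_configs_def outside_configs_def by simp
qed

text \<open>
  The total weight of the three sectors, which vanishes if the marks do not match the turns.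
\<close>
definition star_weight :: "('v \<Rightarrow> real) \<Rightarrow> ('v dart \<Rightarrow> mark) \<Rightarrow> (sector \<Rightarrow> turn) \<Rightarrow> (sector \<Rightarrow> mark) \<Rightarrow>
    real" where
  "star_weight g m t \<nu> = (\<Prod>k\<in>UNIV. star_face (t k) (\<nu> k) (\<nu> (nxt k)) (m (sd k Away)) (m (sd k Back))
      (sqrt (g x) * sqrt (g (opp k))) (sqrt (g (nb k)) * sqrt (g (nb (nxt k))))
      (sqrt (g x * g (opp k) + g (nb k) * g (nb (nxt k)))))"

definition outside_weight :: "('v \<Rightarrow> real) \<Rightarrow> ('v dart \<Rightarrow> 'v dart) \<Rightarrow> ('v dart \<Rightarrow> mark) \<Rightarrow> real" where
  "outside_weight g q m = (\<Prod>f\<in>outside_faces. face_weight M g q (mark_colour \<circ> m) f)"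

lemma face_nonempty: "f \<in> internal_faces M \<Longrightarrow> f \<noteq> {}"
  unfolding internal_faces_def faces_def by (auto simp: orbit_nonempty)

lemma config_weight:
  assumes a: "a = ((q, m), (t, \<nu>))" "a \<in> split_configs bc"
    and g: "g x > 0" "\<And>k. g (nb k) > 0" "\<And>k. g (opp k) > 0"
  shows "(case glue_config a of (p, c, n) \<Rightarrow> \<Prod>f\<in>internal_faces M. face_weight M g p c f) =
    outside_weight g q m * star_weight g m t \<nu>"
proof -
  define p where "p = glue q t"
  define n where "n = glue_marks m \<nu>"
  define c where "c = restrict (mark_colour \<circ> n) (internal_darts M)"
  have c: "c d = (mark_colour \<circ> n) d" if "f \<in> internal_faces M" "d \<in> f" for f d
    using that internal_face_subset unfolding c_def by auto
  have sc: "sector_compatible (t k) n k" for k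
    using a unfolding split_configs_def compatible_with_def n_def glue_marks_sd by blast
  have "face_weight M g p c f = face_weight M g q (mark_colour \<circ> m) f" if f: "f \<in> outside_faces"
      for f
  proof (rule face_weight_cong)
    have i: "f \<in> internal_faces M" using f by (simp add: outside_faces_def)
    then show "f \<noteq> {}" by (rule face_nonempty)
    fix d assume d: "d \<in> f"
    with f have d': "d \<in> \<Union>outside_faces" by blast
    then have d'': "d \<in> outside_darts" using outside_faces_subset by blast
    show "fnext M d \<in> f" using i d by (rule face_closed)
    show "p d = q d" unfolding p_def using d' by (rule glue_outside)
    show "c d = (mark_colour \<circ> m) d" unfolding c[OF i d] using glue_marks_outside[OF d'']
        by (simp add: n_def)
  qed simp_all
  moreover have "face_weight M g p c (sector_of k) = star_face (t k) (\<nu> k) (\<nu> (nxt k))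
      (m (sd k Away)) (m (sd k Back))
      (sqrt (g x) * sqrt (g (opp k))) (sqrt (g (nb k)) * sqrt (g (nb (nxt k))))
      (sqrt (g x * g (opp k) + g (nb k) * g (nb (nxt k))))" for k
  proof -
    have "face_weight M g p c (sector_of k) = face_weight M g p (mark_colour \<circ> n) (sector_of k)"
      by (rule face_weight_cong)
        (simp_all add: face_nonempty[OF sector_of_internal] face_closed[OF sector_of_internal]
            c[OF sector_of_internal])
    also have "\<dots> = star_face (t k) (n (sd k Enter)) (n (sd k Leave)) (n (sd k Away)) (n (sd k Back))
      (sqrt (g x) * sqrt (g (opp k))) (sqrt (g (nb k)) * sqrt (g (nb (nxt k))))
      (sqrt (g x * g (opp k) + g (nb k) * g (nb (nxt k))))"
      by (rule sector_weight_eq[OF _ sc g]) (simp only: p_def glue_sd)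
    finally show ?thesis unfolding n_def glue_marks_sd .
  qed
  moreover have "(\<Prod>f\<in>internal_faces M. face_weight M g p c f) =
    (\<Prod>f\<in>outside_faces. face_weight M g p c f) * (\<Prod>k\<in>UNIV. face_weight M g p c (sector_of k))"
    unfolding internal_faces_eq
    by (subst prod.union_disjoint) (simp_all add: finite_outside_faces outside_faces_disjoint
        prod.reindex[OF inj_sector_of])
  ultimately show ?thesis
    unfolding a glue_config_def prod.case p_def[symmetric] n_def[symmetric] c_def[symmetric]
      outside_weight_def star_weight_def by simp
qed

lemma finite_outside_configs: "finite outside_configs"
proof (rule finite_subset)
  have "finite (\<Union>outside_faces)"
    using outside_faces_subset finite_outside_darts by (rule finite_subset)
  then show "finite ((\<Union>outside_faces \<rightarrow>\<^sub>E \<Union>outside_faces) \<times> (outside_darts \<rightarrow>\<^sub>E (UNIV :: mark set)))"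
    using finite_outside_darts by (intro finite_cartesian_product finite_PiE) simp_all
qed (auto simp: outside_configs_def)

lemma star_weight_nonzero:
  assumes "star_weight g m t \<nu> \<noteq> 0"
  shows "compatible_with m t \<nu>"
  unfolding compatible_with_def
proof
  fix k
  show "marks_match (t k) (\<nu> k) (\<nu> (nxt k)) (m (sd k Away)) (m (sd k Back))"
    using assms unfolding star_weight_def by (intro star_face_nonzero) (auto simp: prod_zero_iff)
qed

text \<open>
  The inner sum runs over all turns and all marks on the spokes, as the terms that do not belong to
  configurations vanish. The boundary condition only enters as a function of the outside and of the
  pairing of the hexagon.
\<close>
lemma Z_mloop_decomposition:
  assumes g: "g x > 0" "\<And>k. g (nb k) > 0" "\<And>k. g (opp k) > 0"
  shows "Z_mloop M bc g = (\<Sum>(q, m)\<in>outside_configs. outside_weight g q m *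
    (\<Sum>t\<in>UNIV. \<Sum>\<nu>\<in>UNIV. of_bool (bc (restrict (mark_colour \<circ> m) (boundary_darts M))
        (outside_connections q (hexagon_pairing D t))) * star_weight g m t \<nu>))"
proof -
  let ?w = "\<lambda>((q, m), (t, \<nu>)). outside_weight g q m * star_weight g m t \<nu>"
  let ?b = "\<lambda>((q, m), (t, \<nu>)). bc (restrict (mark_colour \<circ> m) (boundary_darts M))
    (outside_connections q (hexagon_pairing D t))"
  have "Z_mloop M bc g = (\<Sum>a\<in>split_configs bc. ?w a)"
    unfolding Z_mloop_def
  proof (rule sum.reindex_bij_witness[of _ glue_config split_config])
    fix b assume b: "b \<in> marked_loop_configs M bc"
    show "glue_config (split_config b) = b" "split_config b \<in> split_configs bc"
      using glue_config_split_config[OF b] .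
    obtain q m t \<nu> where s: "split_config b = ((q, m), (t, \<nu>))" by (metis surj_pair)
    show "?w (split_config b) = (case b of (p, c, m) \<Rightarrow> \<Prod>f\<in>internal_faces M. face_weight M g p c f)"
      using config_weight[OF s glue_config_split_config(2)[OF b] g,
          unfolded glue_config_split_config(1)[OF b]]
      unfolding s prod.case by (simp only:)
  qed (rule split_config_glue_config; assumption)+
  also have "\<dots> = (\<Sum>a\<in>outside_configs \<times> UNIV. of_bool (?b a) * ?w a)"
  proof (rule sum.mono_neutral_cong_left)
    show "finite (outside_configs \<times> (UNIV :: ((sector \<Rightarrow> turn) \<times> (sector \<Rightarrow> mark)) set))"
      by (simp add: finite_outside_configs)
    show "split_configs bc \<subseteq> outside_configs \<times> UNIV"
      by (auto simp: split_configs_def)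
    show "\<forall>a\<in>outside_configs \<times> UNIV - split_configs bc. of_bool (?b a) * ?w a = 0"
      by (auto simp: split_configs_def dest: star_weight_nonzero)
    show "?w a = of_bool (?b a) * ?w a" if "a \<in> split_configs bc" for a
      using that by (auto simp: split_configs_def)
  qed
  also have "\<dots> = (\<Sum>b\<in>outside_configs. \<Sum>t\<in>UNIV. \<Sum>\<nu>\<in>UNIV. of_bool (?b (b, (t, \<nu>))) * ?w (b, (t, \<nu>)))"
    by (simp only: sum.cartesian_product' UNIV_Times_UNIV[symmetric])
  also have "\<dots> = (\<Sum>(q, m)\<in>outside_configs. outside_weight g q m *
    (\<Sum>t\<in>UNIV. \<Sum>\<nu>\<in>UNIV. of_bool (bc (restrict (mark_colour \<circ> m) (boundary_darts M))
        (outside_connections q (hexagon_pairing D t))) * star_weight g m t \<nu>))"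
  proof (rule sum.cong[OF refl])
    fix b :: "('v dart \<Rightarrow> 'v dart) \<times> ('v dart \<Rightarrow> mark)"
    obtain q m where b: "b = (q, m)" by fastforce
    show "(\<Sum>t\<in>UNIV. \<Sum>\<nu>\<in>UNIV. of_bool (?b (b, (t, \<nu>))) * ?w (b, (t, \<nu>))) = (case b of (q, m) \<Rightarrow>
        outside_weight g q m *
      (\<Sum>t\<in>UNIV. \<Sum>\<nu>\<in>UNIV. of_bool (bc (restrict (mark_colour \<circ> m) (boundary_darts M))
        (outside_connections q (hexagon_pairing D t))) * star_weight g m t \<nu>))"
      unfolding b prod.case sum_distrib_left by (simp only: mult.left_commute)
  qed
  finally show ?thesis .
qed

end

section \<open>Faces of the quadrangulation\<close>

text \<open>
  The common part of the two kinds of quadrangulations that matters here: the sides of the outer face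
  form a union of facial walks.
\<close>
definition map_with_outer_faces :: "'v quad_map \<Rightarrow> bool" where
  "map_with_outer_faces M \<longleftrightarrow> embedded_graph M \<and> outer M \<subseteq> darts M \<and> fnext M ` outer M \<subseteq> outer M"

lemma cyclic_on_inj_on: "cyclic_on f S \<Longrightarrow> inj_on f S"
proof (rule finite_surj_inj)
  assume c: "cyclic_on f S"
  then show "finite S" by (rule finite_cyclic_on)
  obtain s where s: "s \<in> S" "S = orbit f s" using c unfolding cyclic_on_def by blast
  show "S \<subseteq> f ` S"
  proof
    fix y assume "y \<in> S"
    then have "y \<in> orbit f s" using s by simp
    then show "y \<in> f ` S" using s by cases auto
  qed
qed

lemma darts_facts:
  assumes "embedded_graph M"
  shows "finite (darts M)" "\<And>a b. (a, b) \<in> darts M \<Longrightarrow> (b, a) \<in> darts M"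
    "\<And>a b. (a, b) \<in> darts M \<Longrightarrow> a \<in> vertices M \<and> b \<in> vertices M"
proof -
  interpret pair_graph "ugraph M" using assms by (simp add: embedded_graph_def)
  show "finite (darts M)" by (rule pair_finite_arcs)
  show "(b, a) \<in> darts M" if "(a, b) \<in> darts M" for a b
    using that by (rule arcs_symmetric)
  show "a \<in> vertices M \<and> b \<in> vertices M" if "(a, b) \<in> darts M" for a b
    using that in_arcsD1 in_arcsD2 by blast
qed

text \<open>
  As the rotations are permutations, so is the passage to the next side of a face, and hence the faces
  partition the darts.
\<close>
lemma fnext_permutes_darts:
  assumes M: "embedded_graph M"
  shows "perm_restrict (fnext M) (darts M) permutes darts M" and "fnext M \<in> darts M \<rightarrow> darts M"
proof -
  have rot: "rot M b a \<in> nbrs M b" "cyclic_on (rot M b) (nbrs M b)" "a \<in> nbrs M b"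
      if "(a, b) \<in> darts M" for a b
  proof -
    show "a \<in> nbrs M b" using darts_facts(2)[OF M that] by (simp add: nbrs_def)
    then show "cyclic_on (rot M b) (nbrs M b)"
      using M darts_facts(3)[OF M that] unfolding embedded_graph_def by blast
    then show "rot M b a \<in> nbrs M b" using \<open>a \<in> nbrs M b\<close> by (rule cyclic_on_inI)
  qed
  show maps: "fnext M \<in> darts M \<rightarrow> darts M"
    using rot(1) by (auto simp: fnext_def nbrs_def)
  have "inj_on (fnext M) (darts M)"
  proof (rule inj_onI)
    fix d e assume d: "d \<in> darts M" and e: "e \<in> darts M" and eq: "fnext M d = fnext M e"
    obtain a b a' b' where ab: "d = (a, b)" "e = (a', b')" by fastforce
    have b: "b' = b" using eq by (simp add: ab fnext_def)
    have "rot M b a = rot M b a'" using eq unfolding ab b fnext_def by simp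
    then have "a = a'"
      using cyclic_on_inj_on[OF rot(2)] rot(3) d e unfolding ab b by (meson inj_onD)
    then show "d = e" by (simp add: ab b)
  qed
  then have "bij_betw (fnext M) (darts M) (darts M)"
    using maps darts_facts(1)[OF M] by (simp add: bij_betw_def endo_inj_surj
        image_subset_iff_funcset)
  then show "perm_restrict (fnext M) (darts M) permutes darts M"
    by (intro bij_imp_permutes) (auto simp: perm_restrict_def cong: bij_betw_cong)
qed

lemma face_orbit:
  assumes M: "embedded_graph M" and d: "d \<in> darts M"
  shows "d \<in> orbit (fnext M) d" and "orbit (fnext M) d \<subseteq> darts M"
    and "\<And>e. e \<in> orbit (fnext M) d \<Longrightarrow> orbit (fnext M) e = orbit (fnext M) d"
proof -
  let ?F = "perm_restrict (fnext M) (darts M)"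
  note perm = fnext_permutes_darts[OF M]
  have eq: "orbit (fnext M) e = orbit ?F e" if "e \<in> darts M" for e
    using that perm(2) by (rule orbit_cong0) (simp add: perm_restrict_def)
  have cyc: "cyclic_on ?F (orbit ?F d)"
    using perm(1) darts_facts(1)[OF M] by (rule cyclic_on_orbit)
  show sub: "orbit (fnext M) d \<subseteq> darts M"
    unfolding eq[OF d] using perm(1) d by (rule permutes_orbit_subset)
  have "permutation ?F" using perm(1) darts_facts(1)[OF M] by (auto simp: permutation_permutes)
  then show "d \<in> orbit (fnext M) d"
    unfolding eq[OF d] by (rule permutation_self_in_orbit)
  show "orbit (fnext M) e = orbit (fnext M) d" if "e \<in> orbit (fnext M) d" for e
    using that sub cyc orbit_cyclic_eq3[OF cyc] eq[OF d] eq[of e] by blast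
qed

lemma internal_faces_partition:
  assumes "map_with_outer_faces M"
  shows "\<Union>(internal_faces M) = internal_darts M"
    and "f \<in> internal_faces M \<Longrightarrow> e \<in> f \<Longrightarrow> fnext M e \<in> f"
    and "f \<in> internal_faces M \<Longrightarrow> e \<in> f \<Longrightarrow> f = orbit (fnext M) e"
proof -
  have M: "embedded_graph M" and o: "outer M \<subseteq> darts M" "fnext M ` outer M \<subseteq> outer M"
    using assms by (simp_all add: map_with_outer_faces_def)
  have outer_orbit: "orbit (fnext M) d \<subseteq> outer M" if "d \<in> outer M" for d
  proof
    fix e assume "e \<in> orbit (fnext M) d"
    then show "e \<in> outer M" by induction (use that o in auto)
  qed
  show face: "f = orbit (fnext M) e" if f: "f \<in> internal_faces M" "e \<in> f" for f e
  proof -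
    obtain d where "d \<in> darts M" "f = orbit (fnext M) d"
      using f(1) unfolding internal_faces_def faces_def by blast
    then show ?thesis using face_orbit(3)[OF M] f(2) by simp
  qed
  show "fnext M e \<in> f" if "f \<in> internal_faces M" "e \<in> f"
    using face[OF that] orbit.base by metis
  show "\<Union>(internal_faces M) = internal_darts M"
  proof (intro equalityI subsetI)
    fix d assume "d \<in> \<Union>(internal_faces M)"
    then show "d \<in> internal_darts M"
      using face_orbit(2)[OF M] unfolding internal_faces_def faces_def internal_darts_def by blast
  next
    fix d assume "d \<in> internal_darts M"
    then have d: "d \<in> darts M" "d \<notin> outer M" by (simp_all add: internal_darts_def)
    have "orbit (fnext M) d \<inter> outer M = {}"
      using face_orbit(1,3)[OF M d(1)] outer_orbit d(2) by blast
    then show "d \<in> \<Union>(internal_faces M)"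
      using face_orbit(1)[OF M d(1)] d(1) unfolding internal_faces_def faces_def by blast
  qed
qed

lemma quadrangulation_map_with_outer_faces:
  "planar_quadrangulation M \<or> quadrangulation_with_boundary M \<Longrightarrow> map_with_outer_faces M"
  unfolding planar_quadrangulation_def quadrangulation_with_boundary_def map_with_outer_faces_def
  by auto

lemma UNIV_sector_ball: "(\<forall>k. P k) \<longleftrightarrow> P Sec0 \<and> P Sec1 \<and> P Sec2"
  by (metis sector.exhaust)

lemma range_side: "range f = {f Enter, f Leave, f Away, f Back}"
  by (auto simp: UNIV_side)

lemma cube_hexagon_star:
  assumes M: "map_with_outer_faces M"
    and hex: "cube_hexagon M x v1 v12 v2 v23 v3 v13"
  shows "star M x (case_sector v1 v2 v3) (case_sector v12 v23 v13)"
proof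
  let ?nb = "case_sector v1 v2 v3" and ?opp = "case_sector v12 v23 v13"
  have emb: "embedded_graph M" using M by (simp add: map_with_outer_faces_def)
  have d: "distinct [x, v1, v12, v2, v23, v3, v13]" and nb: "nbrs M x = {v1, v2, v3}"
    using hex by (simp_all add: cube_hexagon_def)
  show "finite (darts M)" by (rule darts_facts(1)[OF emb])
  show "\<Union>(internal_faces M) = internal_darts M" by (rule internal_faces_partition(1)[OF M])
  show "fnext M e \<in> f" if "f \<in> internal_faces M" "e \<in> f" for f e
    using M that by (rule internal_faces_partition(2))
  show "f = f'" if "f \<in> internal_faces M" "f' \<in> internal_faces M" "e \<in> f" "e \<in> f'" for f f' e
    using internal_faces_partition(3)[OF M] that by metis
  show "inj ?nb" "inj ?opp"
    using d by (auto simp: inj_def UNIV_sector_ball)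
  show "?nb k \<noteq> ?opp l" "?nb k \<noteq> x" "?opp k \<noteq> x" for k l
    using d by (cases k; cases l; auto)+
  show "range (\<lambda>s. sector_side x ?nb ?opp (k, s)) \<in> internal_faces M" for k
    using hex unfolding cube_hexagon_def range_side by (cases k) (simp_all add: sector_side.simps)
  show "\<exists>k. (u, v) = (?nb k, x) \<or> (u, v) = (x, ?nb k)" if "(u, v) \<in> darts M" "u = x \<or> v = x" for u v
  proof -
    have "(v, u) \<in> darts M" using that(1) by (rule darts_facts(2)[OF emb])
    then have "u = x \<and> v \<in> nbrs M x \<or> v = x \<and> u \<in> nbrs M x"
      using that by (auto simp: nbrs_def)
    moreover have "\<exists>k. w = ?nb k" if "w \<in> nbrs M x" for w
      using that unfolding nb by (metis insertE singletonD sector.case)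
    ultimately show ?thesis by blast
  qed
qed

section \<open>The flipped map\<close>

lemma orbit_sides:
  assumes "\<And>s. f (E s) = E (next_side s)"
  shows "orbit f (E s) = range E"
proof
  show "orbit f (E s) \<subseteq> range E"
  proof
    fix y assume "y \<in> orbit f (E s)"
    then show "y \<in> range E" by induction (auto simp: assms)
  qed
  have step: "E (next_side r) \<in> orbit f (E s)" if "E r \<in> orbit f (E s)" for r
    using orbit.step[OF that] by (simp add: assms)
  have "E (next_side s) \<in> orbit f (E s)"
    using orbit.base[of f "E s"] by (simp add: assms)
  note 1 = this step[OF this] step[OF step[OF this]] step[OF step[OF step[OF this]]]
  have "E r \<in> orbit f (E s)" for r
    using 1 by (cases s; cases r) simp_all
  then show "range E \<subseteq> orbit f (E s)" by blast
qed

context star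
begin

definition flip :: "'v quad_map" where
  "flip = cube_flip M x (nb Sec0) (opp Sec0) (nb Sec1) (opp Sec1) (nb Sec2) (opp Sec2)"

abbreviation flip_side :: "sector \<Rightarrow> side \<Rightarrow> 'v dart" where
  "flip_side k s \<equiv> sector_side x opp (nb \<circ> nxt) (k, s)"

lemma vertices_flip: "vertices flip = vertices M" and outer_flip: "outer flip = outer M"
  by (simp_all add: flip_def cube_flip_def)

text \<open>
  The flipped map has the same hexagon, with the roles of its sides exchanged.
\<close>
lemma flip_side_hexagon:
  "flip_side k Away = sd (nxt k) Back" "flip_side k Back = sd k Away"
  by (simp_all add: sector_side.simps)

lemma fnext_flip_side: "fnext flip (flip_side k s) = flip_side k (next_side s)"
  by (cases k; cases s) (simp_all add: flip_def cube_flip_def fnext_def sector_side.simps)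

lemma fnext_flip:
  assumes "a \<noteq> x" "b \<noteq> x" "\<And>k. (a, b) \<noteq> sd k Away" "\<And>k. (a, b) \<noteq> sd k Back"
  shows "fnext flip (a, b) = fnext M (a, b)"
  using assms(1,2) assms(3,4)[of Sec0] assms(3,4)[of Sec1] assms(3,4)[of Sec2]
  by (auto simp add: flip_def cube_flip_def fnext_def sector_side.simps)

lemma darts_flip_iff:
  "d \<in> darts flip \<longleftrightarrow> fst d \<noteq> x \<and> snd d \<noteq> x \<and> d \<in> darts M \<or>
     (\<exists>k. d = flip_side k Enter \<or> d = flip_side k Leave)"
proof -
  have ex: "(\<exists>k. P k) \<longleftrightarrow> P Sec0 \<or> P Sec1 \<or> P Sec2" for P
    by (metis sector.exhaust)
  show ?thesis
    unfolding ex by (cases d) (auto simp: flip_def cube_flip_def sector_side.simps)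
qed

lemma flip_side_darts:
  assumes outer: "outer M \<subseteq> darts M"
  shows "flip_side k s \<in> darts flip" and "flip_side k s \<notin> outer M"
proof -
  have hexagon: "sd l r \<in> darts M" "sd l r \<notin> outer M" for l r
    using sd_internal[of l r] by (simp_all add: internal_darts_def)
  have hexagon_flip: "sd l Away \<in> darts flip" "sd l Back \<in> darts flip" for l
    unfolding darts_flip_iff using hexagon[of l] sd_outside[of l Away] sd_outside[of l Back]
    by (simp_all add: outside_darts_def)
  have spoke: "(opp l, x) \<notin> darts M" "(x, opp l) \<notin> darts M" for l
    using centre_darts[of "opp l" x] centre_darts[of x "opp l"] by auto
  consider "s = Enter" | "s = Leave" | "s = Away" | "s = Back" by (cases s)
  then show "flip_side k s \<in> darts flip"
  proof cases
    case 3
    then show ?thesis unfolding flip_side_hexagon using hexagon_flip(2)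
        by (simp only: flip_side_hexagon)
  next
    case 4
    then show ?thesis using hexagon_flip(1) by (simp only: flip_side_hexagon)
  qed (auto simp only: darts_flip_iff)
  show "flip_side k s \<notin> outer M"
  proof (cases s)
    case Enter
    then show ?thesis using outer spoke(1)[of k] by (auto simp: sector_side.simps)
  next
    case Leave
    then show ?thesis using outer spoke(2)[of "nxt k"] by (auto simp: sector_side.simps)
  qed (simp_all only: flip_side_hexagon hexagon(2) not_False_eq_True)
qed

lemma outside_face_flip:
  assumes f: "f \<in> outside_faces" and d: "d \<in> f"
  shows "fnext flip d = fnext M d" and "orbit (fnext flip) d = orbit (fnext M) d"
      and "d \<in> darts flip"
proof -
  have fnext: "fnext flip e = fnext M e" if "e \<in> f" for e
  proof -
    have "e \<in> outside_darts" using that f outside_faces_subset by blast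
    moreover have "e \<noteq> sd k s" for k s using that f sd_notin_outside_faces by blast
    ultimately show ?thesis
      using fnext_flip[of "fst e" "snd e"] unfolding prod.collapse outside_darts_def by blast
  qed
  show "fnext flip d = fnext M d" using d by (rule fnext)
  show "orbit (fnext flip) d = orbit (fnext M) d"
    by (rule orbit_cong0[OF d]) (use outside_face_closed[OF f] fnext in auto)
  have "d \<in> outside_darts" using d f outside_faces_subset by blast
  then show "d \<in> darts flip"
    using darts_flip_iff[of d] by (simp add: outside_darts_def internal_darts_def)
qed

text \<open>
  A facial walk of the flipped map through a new spoke or a side of the hexagon runs around one of the
  new sectors. At all the other darts the passage to the next side is the old one, so the remaining
  facial walks are the outside faces and those that contain a side of the outer face.
\<close>
lemma internal_faces_flip:
  assumes M: "map_with_outer_faces M"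
  shows "internal_faces flip = outside_faces \<union> range (\<lambda>k. range (flip_side k))"
proof (intro equalityI subsetI)
  have outer: "outer M \<subseteq> darts M" "fnext M ` outer M \<subseteq> outer M"
    using M by (simp_all add: map_with_outer_faces_def)
  have side: "orbit (fnext flip) (flip_side k s) = range (flip_side k)" for k s
    using orbit_sides[of "fnext flip" "flip_side k" s] fnext_flip_side by blast
  fix f
  {
    assume "f \<in> internal_faces flip"
    then obtain d where d: "d \<in> darts flip" "f = orbit (fnext flip) d" and o: "f \<inter> outer M = {}"
      unfolding internal_faces_def faces_def outer_flip by blast
    show "f \<in> outside_faces \<union> range (\<lambda>k. range (flip_side k))"
    proof (cases "\<exists>k s. d = flip_side k s")
      case True
      then show ?thesis using side d(2) by auto
    next
      case False
      have ab: "fst d \<noteq> x" "snd d \<noteq> x" "d \<in> darts M"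
        using d(1) False darts_flip_iff[of d] by auto
      have hexagon: "d \<noteq> sd k Away" "d \<noteq> sd k Back" for k
      proof -
        obtain l where "k = nxt l" using ex_nxt by blast
        then show "d \<noteq> sd k Away" "d \<noteq> sd k Back"
          using False flip_side_hexagon[of k] flip_side_hexagon[of l] by metis+
      qed
      have eq: "fnext flip d = fnext M d"
        using fnext_flip[of "fst d" "snd d"] ab hexagon by simp
      have "d \<notin> outer M"
      proof
        assume "d \<in> outer M"
        then have "fnext flip d \<in> outer M" using outer(2) eq by auto
        then show False using o orbit.base[of "fnext flip" d] d(2) by blast
      qed
      then have "d \<in> internal_darts M" using ab by (simp add: internal_darts_def)
      moreover have "d \<noteq> sd k s" for k s
        using ab hexagon by (cases s) (auto simp: sector_side.simps)
      ultimately obtain h where h: "h \<in> outside_faces" "d \<in> h"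
        using internal_cases by (metis UnionE)
      have "h = orbit (fnext M) d"
        using internal_faces_partition(3)[OF M _ h(2)] h(1) by (simp add: outside_faces_def)
      then have "f = h" using outside_face_flip(2)[OF h] d(2) by simp
      then show ?thesis using h(1) by simp
    qed
  next
    assume "f \<in> outside_faces \<union> range (\<lambda>k. range (flip_side k))"
    then show "f \<in> internal_faces flip"
    proof
      assume f: "f \<in> outside_faces"
      then have i: "f \<in> internal_faces M" by (simp add: outside_faces_def)
      then obtain d where d: "d \<in> f" using face_nonempty by blast
      have "f = orbit (fnext flip) d"
        using internal_faces_partition(3)[OF M i d] outside_face_flip(2)[OF f d] by simp
      moreover have "f \<inter> outer M = {}" using i by (simp add: internal_faces_def)
      ultimately show ?thesis
        using outside_face_flip(3)[OF f d] unfolding internal_faces_def faces_def outer_flip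
            by blast
    next
      assume "f \<in> range (\<lambda>k. range (flip_side k))"
      then obtain k where "f = range (flip_side k)" by blast
      then have "f = orbit (fnext flip) (flip_side k Enter)" "f \<inter> outer M = {}"
        using side flip_side_darts(2)[OF outer(1)] by auto
      then show ?thesis
        using flip_side_darts(1)[OF outer(1)] unfolding internal_faces_def faces_def outer_flip
            by blast
    qed
  }
qed

lemma flip_side_eq_iff: "flip_side k s = flip_side l r \<longleftrightarrow> k = l \<and> s = r"
  by (cases s; cases r) (auto simp: sector_side.simps)

lemma flip_side_notin_outside: "f \<in> outside_faces \<Longrightarrow> flip_side k s \<notin> f"
proof
  assume f: "f \<in> outside_faces" "flip_side k s \<in> f"
  then have "flip_side k s \<in> outside_darts" using outside_faces_subset by blast
  then have "s = Away \<or> s = Back"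
    by (cases s) (auto simp: outside_darts_def sector_side.simps)
  then show False using f flip_side_hexagon sd_notin_outside_faces by metis
qed

text \<open>
  The flipped map is again a map with a star, so the decomposition applies to it.
\<close>
lemma star_flip:
  assumes M: "map_with_outer_faces M"
  shows "star flip x opp (nb \<circ> nxt)"
proof
  have outer: "outer M \<subseteq> darts M" using M by (simp add: map_with_outer_faces_def)
  note faces = internal_faces_flip[OF M]
  have "darts flip \<subseteq> darts M \<union> range (\<lambda>k. flip_side k Enter) \<union> range (\<lambda>k. flip_side k Leave)"
    using darts_flip_iff by auto
  then show "finite (darts flip)"
    by (rule finite_subset) (simp add: finite_darts)
  show "fnext flip d \<in> f" if f: "f \<in> internal_faces flip" and d: "d \<in> f" for f d
  proof -
    consider "f \<in> outside_faces" | k where "f = range (flip_side k)"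
      using f unfolding faces by blast
    then show ?thesis
    proof cases
      case 1
      then show ?thesis using outside_face_flip(1)[OF 1 d] outside_face_closed[OF 1 d]
          by (simp only:)
    next
      case 2
      then show ?thesis using d fnext_flip_side by auto
    qed
  qed
  show "f = f'" if "f \<in> internal_faces flip" "f' \<in> internal_faces flip" "d \<in> f" "d \<in> f'" for f f' d
  proof (cases "\<exists>k s. d = flip_side k s")
    case True
    then show ?thesis
      using that flip_side_notin_outside flip_side_eq_iff unfolding faces by auto
  next
    case False
    then have "f \<in> outside_faces" "f' \<in> outside_faces" using that unfolding faces by auto
    then show ?thesis using that(3,4) face_unique by (simp add: outside_faces_def)
  qed
  show "\<Union>(internal_faces flip) = internal_darts flip"
  proof (intro equalityI subsetI)
    fix d assume "d \<in> \<Union>(internal_faces flip)"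
    then consider f where "f \<in> outside_faces" "d \<in> f" | k s where "d = flip_side k s"
      unfolding faces by auto
    then show "d \<in> internal_darts flip"
    proof cases
      case 1
      then have "d \<notin> outer M" by (auto simp: outside_faces_def internal_faces_def)
      then show ?thesis using outside_face_flip(3)[OF 1]
          by (simp add: internal_darts_def outer_flip)
    next
      case 2
      then show ?thesis using flip_side_darts[OF outer] by (simp add: internal_darts_def outer_flip)
    qed
  next
    fix d assume "d \<in> internal_darts flip"
    then have d: "d \<in> darts flip" "d \<notin> outer M" by (simp_all add: internal_darts_def outer_flip)
    show "d \<in> \<Union>(internal_faces flip)"
    proof (cases "\<exists>k s. d = flip_side k s")
      case True
      then show ?thesis unfolding faces by blast
    next
      case False
      have ab: "fst d \<noteq> x" "snd d \<noteq> x" "d \<in> internal_darts M"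
        using d False darts_flip_iff[of d] by (auto simp: internal_darts_def)
      have "d \<noteq> sd k s" for k s
      proof -
        obtain l where "k = nxt l" using ex_nxt by blast
        then show ?thesis
          using ab False flip_side_hexagon[of k] flip_side_hexagon[of l]
          by (cases s) (metis fst_conv snd_conv sector_side.simps)+
      qed
      then have "d \<in> \<Union>outside_faces" using internal_cases[OF ab(3)] by metis
      then show ?thesis unfolding faces by blast
    qed
  qed
  show "inj opp" by (rule inj_opp)
  show "inj (nb \<circ> nxt)" by (auto simp: inj_def)
  show "range (\<lambda>s. flip_side k s) \<in> internal_faces flip" for k
    unfolding faces by blast
  show "\<exists>k. (u, v) = (opp k, x) \<or> (u, v) = (x, opp k)" if "(u, v) \<in> darts flip" "u = x \<or> v = x"
      for u v
    using that darts_flip_iff[of "(u, v)"] by (auto simp: sector_side.simps)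
qed simp_all

end

section \<open>Invariance under the flip\<close>

lemma sum_sector_fun:
  fixes F :: "(sector \<Rightarrow> 'a::finite) \<Rightarrow> real"
  shows "(\<Sum>t\<in>UNIV. F t) = (\<Sum>t0\<in>UNIV. \<Sum>t1\<in>UNIV. \<Sum>t2\<in>UNIV. F (case_sector t0 t1 t2))"
proof -
  have "(\<Sum>t\<in>UNIV. F t) = (\<Sum>(t0, t1, t2)\<in>UNIV \<times> UNIV \<times> UNIV. F (case_sector t0 t1 t2))"
  proof (rule sum.reindex_bij_witness[where i = "\<lambda>(t0, t1, t2). case_sector t0 t1 t2"
        and j = "\<lambda>t. (t Sec0, t Sec1, t Sec2)"])
    fix t :: "sector \<Rightarrow> 'a"
    show eq: "(case (t Sec0, t Sec1, t Sec2) of (t0, t1, t2) \<Rightarrow> case_sector t0 t1 t2) = t"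
      by (rule ext) (simp split: sector.split)
    show "(case (t Sec0, t Sec1, t Sec2) of (t0, t1, t2) \<Rightarrow> F (case_sector t0 t1 t2)) = F t"
      using eq by simp
  qed auto
  then show ?thesis by (simp only: sum.cartesian_product' prod.case)
qed

context star
begin

lemma star_weight_sum:
  "(\<Sum>t\<in>UNIV. \<Sum>\<nu>\<in>UNIV. \<beta> (hexagon_pairing D t) * star_weight g m t \<nu>) =
   (\<Sum>t0\<in>UNIV. \<Sum>t1\<in>UNIV. \<Sum>t2\<in>UNIV.
      \<beta> (star_pairing t0 t1 t2 (sd Sec2 Away) (sd Sec0 Back) (sd Sec0 Away) (sd Sec1 Back)
          (sd Sec1 Away) (sd Sec2 Back)) *
      star_term t0 t1 t2 (m (sd Sec2 Away)) (m (sd Sec0 Back)) (m (sd Sec0 Away)) (m (sd Sec1 Back))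
        (m (sd Sec1 Away)) (m (sd Sec2 Back))
        (sqrt (g x)) (sqrt (g (nb Sec0))) (sqrt (g (nb Sec1))) (sqrt (g (nb Sec2)))
        (sqrt (g (opp Sec0))) (sqrt (g (opp Sec1))) (sqrt (g (opp Sec2)))
        (sqrt (g x * g (opp Sec0) + g (nb Sec0) * g (nb Sec1)))
        (sqrt (g x * g (opp Sec1) + g (nb Sec1) * g (nb Sec2)))
        (sqrt (g x * g (opp Sec2) + g (nb Sec2) * g (nb Sec0))))"
  unfolding sum_sector_fun star_term_def star_weight_def hexagon_pairing_def sum_distrib_left
  by (simp add: UNIV_sector mult.assoc)

lemma boundary_darts_outside: "boundary_darts M = {d \<in> outside_darts. prod.swap d \<in> outer M}"
  using boundary_darts_subset outside_subset unfolding boundary_darts_def by blast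

text \<open>
  Outside of the hexagon the two maps have the same faces, configurations and connections, so the two
  decompositions run over the same set.
\<close>
lemma outside_flip:
  assumes M: "map_with_outer_faces M"
  shows "star.outside_faces flip x opp (nb \<circ> nxt) = outside_faces"
    and "star.outside_darts flip x = outside_darts"
    and "boundary_darts flip = boundary_darts M"
    and "star.outside_configs flip x opp (nb \<circ> nxt) = outside_configs"
    and "star.outside_connections flip x opp (nb \<circ> nxt) q \<pi> = outside_connections q \<pi>"
proof -
  interpret F: star flip x opp "nb \<circ> nxt" using M by (rule star_flip)
  have "range (flip_side k) \<notin> outside_faces" for k
    using flip_side_notin_outside by blast
  then show faces: "F.outside_faces = outside_faces"
    unfolding F.outside_faces_def F.sector_of_def internal_faces_flip[OF M] by blast
  have "d \<in> darts flip \<longleftrightarrow> d \<in> darts M" if "fst d \<noteq> x" "snd d \<noteq> x" for d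
    using that unfolding darts_flip_iff by (auto simp: sector_side.simps)
  then show darts: "F.outside_darts = outside_darts"
    unfolding F.outside_darts_def outside_darts_def internal_darts_def outer_flip by blast
  show bd: "boundary_darts flip = boundary_darts M"
    unfolding F.boundary_darts_outside boundary_darts_outside darts outer_flip ..
  have fnext: "fnext flip d = fnext M d" "fnext M d \<in> \<Union>outside_faces" if "d \<in> \<Union>outside_faces" for d
    using that outside_face_flip(1) outside_face_closed by blast+
  then have "(\<forall>d\<in>\<Union>outside_faces. marking_at flip q m d) = (\<forall>d\<in>\<Union>outside_faces. marking_at M q m d)"
      for q m
    unfolding marking_at_def by (intro ball_cong refl) metis
  moreover have "(\<forall>f\<in>outside_faces. local_config flip f q c)
      = (\<forall>f\<in>outside_faces. local_config M f q c)" for q c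
  proof (intro ball_cong refl)
    fix f assume "f \<in> outside_faces"
    have "fnext flip (fnext flip d) = fnext M (fnext M d) \<and> fnext flip d = fnext M d" if "d \<in> f"
        for d
      using \<open>d \<in> f\<close> \<open>f \<in> outside_faces\<close> fnext by (metis UnionI)
    then show "local_config flip f q c = local_config M f q c" unfolding local_config_def by metis
  qed
  ultimately show "F.outside_configs = outside_configs"
    unfolding F.outside_configs_def outside_configs_def faces darts by (simp only:)
  show "F.outside_connections q \<pi> = outside_connections q \<pi>"
    unfolding F.outside_connections_def outside_connections_def F.outside_rel_def outside_rel_def
      faces darts bd ..
qed

lemma outside_weight_flip:
  assumes M: "map_with_outer_faces M"
    and g: "\<And>v. v \<in> vertices M \<Longrightarrow> v \<noteq> x \<Longrightarrow> g' v = g v"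
  shows "star.outside_weight flip x opp (nb \<circ> nxt) g' q m = outside_weight g q m"
proof -
  interpret F: star flip x opp "nb \<circ> nxt" using M by (rule star_flip)
  have emb: "embedded_graph M" using M by (simp add: map_with_outer_faces_def)
  have "face_weight flip g' q (mark_colour \<circ> m) f = face_weight M g q (mark_colour \<circ> m) f"
    if f: "f \<in> outside_faces" for f
  proof (rule face_weight_cong[symmetric])
    have i: "f \<in> internal_faces M" using f by (simp add: outside_faces_def)
    then show "f \<noteq> {}" by (rule face_nonempty)
    fix d assume d: "d \<in> f"
    show "fnext M d \<in> f" using i d by (rule face_closed)
    show "fnext flip d = fnext M d" by (rule outside_face_flip(1)[OF f d])
    have "d \<in> outside_darts" using f d outside_faces_subset by blast
    then have "fst d \<noteq> x" "(fst d, snd d) \<in> darts M"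
      by (simp_all add: outside_darts_def internal_darts_def)
    then show "g (fst d) = g' (fst d)" using darts_facts(3)[OF emb] g by metis
  qed simp_all
  then show ?thesis
    unfolding F.outside_weight_def outside_weight_def outside_flip(1)[OF M]
        by (rule prod.cong[OF refl])
qed

text \<open>
  The two decompositions agree term by term, by the local identity with \<open>\<beta>\<close> the indicator of the
  boundary condition for the given outside.
\<close>
theorem Z_mloop_flip:
  assumes M: "map_with_outer_faces M"
    and pos: "g x > 0" "\<And>k. g (nb k) > 0" "\<And>k. g (opp k) > 0"
    and g: "\<And>v. v \<in> vertices M \<Longrightarrow> v \<noteq> x \<Longrightarrow> g' v = g v"
    and g': "g' x = kashaev (g x) (g (nb Sec0)) (g (nb Sec1)) (g (nb Sec2)) (g (opp Sec0))
        (g (opp Sec2)) (g (opp Sec1))"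
  shows "1 / (g x)\<^sup>2 * Z_mloop M bc g = 1 / (g' x)\<^sup>2 * Z_mloop flip bc g'"
proof -
  interpret F: star flip x opp "nb \<circ> nxt" using M by (rule star_flip)
  have emb: "embedded_graph M" using M by (simp add: map_with_outer_faces_def)
  have "(nb k, x) \<in> darts M" "(nb (nxt k), opp k) \<in> darts M" for k
    using sd_internal[of k Enter] sd_internal[of k Away]
        by (simp_all add: internal_darts_def sector_side.simps)
  then have g'_hexagon: "g' (nb k) = g (nb k)" "g' (opp k) = g (opp k)" for k
    using darts_facts(3)[OF emb] g distinct'(2,3) by metis+
  note cube = kashaev_cube_sqrt[OF pos(1) pos(2)[of Sec0] pos(2)[of Sec1] pos(2)[of Sec2]
      pos(3)[of Sec0] pos(3)[of Sec1] pos(3)[of Sec2] g']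
  have pos': "g' x > 0" "\<And>k. g' (opp k) > 0" "\<And>k. g' ((nb \<circ> nxt) k) > 0"
    using cube(1) pos by (simp_all add: g'_hexagon)
  have four: "sqrt a ^ 4 = a\<^sup>2" if "a > 0" for a :: real
    using that by (simp add: power4_eq_xxxx power2_eq_square mult.assoc[symmetric])
  have star_sum: "(g' x)\<^sup>2 * (\<Sum>t\<in>UNIV. \<Sum>\<nu>\<in>UNIV. \<beta> (hexagon_pairing D t) * star_weight g m t \<nu>) =
      (g x)\<^sup>2 * (\<Sum>t\<in>UNIV. \<Sum>\<nu>\<in>UNIV. \<beta> (hexagon_pairing F.D t) * F.star_weight g' m t \<nu>)" for \<beta> m
  proof -
    have hexagon: "F.sd Sec2 Away = sd Sec0 Back" "F.sd Sec0 Back = sd Sec0 Away"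
      "F.sd Sec0 Away = sd Sec1 Back" "F.sd Sec1 Back = sd Sec1 Away"
          "F.sd Sec1 Away = sd Sec2 Back"
      "F.sd Sec2 Back = sd Sec2 Away"
      by (simp_all add: sector_side.simps)
    show ?thesis
      unfolding star_weight_sum F.star_weight_sum hexagon comp_apply nxt.simps g'_hexagon
        four[OF pos(1), symmetric] four[OF pos'(1), symmetric]
      by (rule star_sum_flip[OF cube(2)])
  qed
  define A where "A = (\<lambda>(q, m). outside_weight g q m * (\<Sum>t\<in>UNIV. \<Sum>\<nu>\<in>UNIV.
     of_bool (bc (restrict (mark_colour \<circ> m) (boundary_darts M))
         (outside_connections q (hexagon_pairing D t))) * star_weight g m t \<nu>))"
  define B where "B = (\<lambda>(q, m). outside_weight g q m * (\<Sum>t\<in>UNIV. \<Sum>\<nu>\<in>UNIV.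
     of_bool (bc (restrict (mark_colour \<circ> m) (boundary_darts M))
         (outside_connections q (hexagon_pairing F.D t))) * F.star_weight g' m t \<nu>))"
  have "(g' x)\<^sup>2 * A a = (g x)\<^sup>2 * B a" for a
  proof -
    obtain q m where a: "a = (q, m)" by fastforce
    show ?thesis
      unfolding A_def B_def a prod.case mult.left_commute[of _ "outside_weight g q m"]
        star_sum[of "\<lambda>\<pi>. of_bool (bc (restrict (mark_colour \<circ> m) (boundary_darts M))
            (outside_connections q \<pi>))" m] ..
  qed
  moreover have "Z_mloop M bc g = (\<Sum>a\<in>outside_configs. A a)"
    unfolding A_def by (rule Z_mloop_decomposition[OF pos])
  moreover have "F.outside_weight g' q m = outside_weight g q m" for q m
    using M g by (rule outside_weight_flip)
  then have "Z_mloop flip bc g' = (\<Sum>a\<in>outside_configs. B a)"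
    using F.Z_mloop_decomposition[of g' bc, OF pos']
    unfolding B_def outside_flip[OF M] by (simp only:)
  ultimately have "(g' x)\<^sup>2 * Z_mloop M bc g = (g x)\<^sup>2 * Z_mloop flip bc g'"
    by (simp add: sum_distrib_left)
  then show ?thesis
    using pos(1) pos'(1) by (simp add: field_simps)
qed

end

theorem theorem2:
  fixes M M' :: "'v quad_map" and g g' :: "'v \<Rightarrow> real" and bc :: "'v boundary_condition"
    and x v1 v2 v3 v12 v13 v23 :: 'v
  assumes "planar_quadrangulation M \<or> quadrangulation_with_boundary M"
    and "\<forall>v\<in>vertices M. g v > 0"
    and "cube_hexagon M x v1 v12 v2 v23 v3 v13"
    and "M' = cube_flip M x v1 v12 v2 v23 v3 v13"
    and "\<forall>v\<in>vertices M' - {x}. g' v = g v"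
    and "g' x = kashaev (g x) (g v1) (g v2) (g v3) (g v12) (g v13) (g v23)"
  shows "1 / (g x)\<^sup>2 * Z_mloop M bc g = 1 / (g' x)\<^sup>2 * Z_mloop M' bc g'"
proof -
  have M: "map_with_outer_faces M"
    using assms(1) by (rule quadrangulation_map_with_outer_faces)
  let ?nb = "case_sector v1 v2 v3" and ?opp = "case_sector v12 v23 v13"
  interpret star M x ?nb ?opp
    using M assms(3) by (rule cube_hexagon_star)
  have M': "M' = flip" unfolding assms(4) flip_def by simp
  have "(?nb k, x) \<in> darts M" "(?nb (nxt k), ?opp k) \<in> darts M" for k
    using sd_internal[of k Enter] sd_internal[of k Away]
        by (simp_all add: internal_darts_def sector_side.simps)
  then have "x \<in> vertices M" "?nb k \<in> vertices M" "?opp k \<in> vertices M" for k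
    using darts_facts(3)[of M] M unfolding map_with_outer_faces_def by blast+
  then have pos: "g x > 0" "g (?nb k) > 0" "g (?opp k) > 0" for k
    using assms(2) by blast+
  show ?thesis
    unfolding M'
  proof (rule Z_mloop_flip[OF M pos])
    show "g' v = g v" if "v \<in> vertices M" "v \<noteq> x" for v
      using assms(5) that unfolding M' vertices_flip by blast
    show "g' x = kashaev (g x) (g (?nb Sec0)) (g (?nb Sec1)) (g (?nb Sec2)) (g (?opp Sec0))
        (g (?opp Sec2)) (g (?opp Sec1))"
      using assms(6) by simp
  qed
qed

end
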